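(* Let $\mathcal{A}\subset\mathbb{Z}^d$ be a primitive finite set and let $w=(w_{\mathbf a}\mid\mathbf a\in\mathcal{A})\in\mathbb{R}_{>0}^{\mathcal{A}}$ be positive weights. Let $F_{\mathcal{A},w}$ be the homogenization, with respect to a new variable $x_0$, of $f_{\mathcal{A},w}=\sum_{\mathbf a\in\mathcal{A}}w_{\mathbf a}x^{\mathbf a}$. The toric patch of shape $(\mathcal{A},w)$ has rational linear precision if and only if the rational map $D_{\mathrm{torus}}F_{\mathcal{A},w}\colon\mathbb{C}\mathbb{P}^d\dashrightarrow\mathbb{C}\mathbb{P}^d$, $$D_{\mathrm{torus}}F_{\mathcal{A},w}=\Bigl[x_0\frac{\partial}{\partial x_0}F_{\mathcal{A},w}:x_1\frac{\partial}{\partial x_1}F_{\mathcal{A},w}:\dotsb:x_d\frac{\partial}{\partial x_d}F_{\mathcal{A},w}\Bigr],$$ is a birational isomorphism.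
   Context: For $\mathbf a=(a_1,\dotsc,a_d)\in\mathbb{Z}^d$, $x^{\mathbf a}:=x_1^{a_1}\dotsb x_d^{a_d}$ and $|\mathbf a|:=a_1+\dotsb+a_d$. With $n:=\max\{|\mathbf a|\mid\mathbf a\in\mathcal{A}\}$ the degree of $f_{\mathcal{A},w}$, the homogenization is $F_{\mathcal{A},w}=\sum_{\mathbf a\in\mathcal{A}}w_{\mathbf a}x_0^{\,n-|\mathbf a|}x^{\mathbf a}$, homogeneous of degree $n$. The set $\mathcal{A}$ is primitive if it affinely spans $\mathbb{Z}^d$ (every element of $\mathbb{Z}^d$ is an integer affine combination of elements of $\mathcal{A}$); its convex hull $\Delta$ then has dimension $d$. A (parametric) patch indexed by $\mathcal{A}$ is a collection $\{\beta_{\mathbf a}\mid\mathbf a\in\mathcal{A}\}$ of non-negative real-valued functions (blending functions), smooth where defined, with common domain $\Delta$, that do not vanish simultaneously at any point of $\Delta$. They may be normalized by dividing by $\sum_{\mathbf b}\beta_{\mathbf b}$, so that they sum to $1$. The (normalized) patch has linear precision if for every affine function $\Lambda$ on $\mathbb{R}^d$, $\Lambda(x)=\sum_{\mathbf a}\beta_{\mathbf a}(x)\Lambda(\mathbf a)$ for all $x\in\Delta$. Its tautological map is $\tau\colon\Delta\to\Delta$, $\tau(x)=\sum_{\mathbf a}\beta_{\mathbf a}(x)\mathbf a$ (normalized $\beta_{\mathbf a}$); the patch is proper if $\tau$ is a homeomorphism. The reparametrization by a homeomorphism $\psi\colon\Delta\to\Delta$ is the patch $\{\beta_{\mathbf a}\circ\psi\}$.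 A proper patch has a unique reparametrization with linear precision (namely by $\psi=\tau^{-1}$). A patch has rational linear precision if it is proper and its reparametrization having linear precision has blending functions that are rational functions (quotients of polynomials). Let $\mathbb{R}\mathbb{P}^{\mathcal{A}}$ be the real projective space with homogeneous coordinates indexed by $\mathcal{A}$, and let $X_{\mathcal{A},w}\subset\mathbb{R}\mathbb{P}^{\mathcal{A}}$ be the closure of the image of $\mathbb{R}_{>0}^d$ under $x\mapsto[w_{\mathbf a}x^{\mathbf a}\mid\mathbf a\in\mathcal{A}]$. A toric patch of shape $(\mathcal{A},w)$ is any patch $\{\beta_{\mathbf a}\mid\mathbf a\in\mathcal{A}\}$ such that the image of $\Delta$ under $x\mapsto[\beta_{\mathbf a}(x)\mid\mathbf a\in\mathcal{A}]$ equals $X_{\mathcal{A},w}$. A rational map is a birational isomorphism if it has an inverse rational map, the two composites being the identity where they are defined.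
   Formalization: The degree n = max |a| is assumed nonzero; for n = 0 Euler's relation puts the image of D_torus F in a hyperplane, and the claim fails, e.g. d = 1, A = {-1,0}, w = (1,1), where D_torus F = [1:-1] but the patch has rational linear precision. *)

theory Defs
  imports "HOL-Analysis.Analysis"
begin

section \<open>Exponents\<close>

definition real_vec :: "int^'d \<Rightarrow> real^'d" where
  "real_vec a = (\<chi> i. real_of_int (a $ i))"

definition Delta :: "(int^'d) set \<Rightarrow> (real^'d) set" where
  "Delta A = convex hull (real_vec ` A)"

definition primitive :: "(int^'d) set \<Rightarrow> bool" where
  "primitive A \<longleftrightarrow>
     (\<forall>z. \<exists>k :: int^'d \<Rightarrow> int. (\<Sum>a\<in>A. k a) = 1 \<and> z = (\<Sum>a\<in>A. k a *s a))"

definition total_deg :: "int^'d \<Rightarrow> int" where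
  "total_deg a = (\<Sum>i\<in>UNIV. a $ i)"

text \<open>The degree \<open>n\<close> of \<open>f\<close>. For a Laurent polynomial with \<open>n = 0\<close>, Euler's relation
  \<open>\<Sum>\<^sub>j x\<^sub>j \<partial>F/\<partial>x\<^sub>j = n F\<close> confines the toric derivative to a hyperplane, so it is never
  birational; if \<open>\<A>\<close> is primitive with non-negative entries, then \<open>n > 0\<close>.\<close>

definition max_deg :: "(int^'d) set \<Rightarrow> int" where
  "max_deg A = Max (total_deg ` A)"


section \<open>Parametric patches\<close>

text \<open>\<open>Ck_on k U f\<close>: \<open>f\<close> is \<open>k\<close> times continuously differentiable on the open set \<open>U\<close>;
  the witness \<open>g i\<close> is the \<open>i\<close>-th partial derivative.\<close>

primrec Ck_on :: "nat \<Rightarrow> (real^'d) set \<Rightarrow> (real^'d \<Rightarrow> real) \<Rightarrow> bool" where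
  "Ck_on 0 U f \<longleftrightarrow> continuous_on U f"
| "Ck_on (Suc k) U f \<longleftrightarrow>
     (\<exists>g. (\<forall>x\<in>U. (f has_derivative (\<lambda>h. \<Sum>i\<in>UNIV. g i x * h $ i)) (at x)) \<and>
          (\<forall>i::'d. Ck_on k U (g i)))"

text \<open>Blending functions only matter for indices in \<open>A\<close> and points of \<open>\<Delta>\<close>. ``Smooth where
  defined'' is read as: continuous on \<open>\<Delta>\<close> and infinitely differentiable in its interior.
  Smoothness up to the boundary is not required, as it would exclude rational blending functions
  such as \<open>u * v / (1 - t)\<close> (extended continuously) at a non-simple vertex of \<open>\<Delta>\<close>.\<close>

definition patch :: "(int^'d) set \<Rightarrow> (int^'d \<Rightarrow> real^'d \<Rightarrow> real) \<Rightarrow> bool" where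
  "patch A \<beta> \<longleftrightarrow>
     (\<forall>a\<in>A. (\<forall>x\<in>Delta A. 0 \<le> \<beta> a x) \<and> continuous_on (Delta A) (\<beta> a) \<and>
             (\<forall>k. Ck_on k (interior (Delta A)) (\<beta> a))) \<and>
     (\<forall>x\<in>Delta A. \<exists>a\<in>A. \<beta> a x \<noteq> 0)"

definition normalized ::
    "(int^'d) set \<Rightarrow> (int^'d \<Rightarrow> real^'d \<Rightarrow> real) \<Rightarrow> (int^'d \<Rightarrow> real^'d \<Rightarrow> real)" where
  "normalized A \<beta> = (\<lambda>a x. \<beta> a x / (\<Sum>b\<in>A. \<beta> b x))"

definition linear_precision :: "(int^'d) set \<Rightarrow> (int^'d \<Rightarrow> real^'d \<Rightarrow> real) \<Rightarrow> bool" where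
  "linear_precision A \<beta> \<longleftrightarrow>
     (\<forall>(L :: real^'d \<Rightarrow> real) c. linear L \<longrightarrow>
        (\<forall>x\<in>Delta A. L x + c = (\<Sum>a\<in>A. normalized A \<beta> a x * (L (real_vec a) + c))))"

definition tautological_map ::
    "(int^'d) set \<Rightarrow> (int^'d \<Rightarrow> real^'d \<Rightarrow> real) \<Rightarrow> real^'d \<Rightarrow> real^'d" where
  "tautological_map A \<beta> x = (\<Sum>a\<in>A. normalized A \<beta> a x *\<^sub>R real_vec a)"

definition proper_patch :: "(int^'d) set \<Rightarrow> (int^'d \<Rightarrow> real^'d \<Rightarrow> real) \<Rightarrow> bool" where
  "proper_patch A \<beta> \<longleftrightarrow>
     patch A \<beta> \<and> (\<exists>\<sigma>. homeomorphism (Delta A) (Delta A) (tautological_map A \<beta>) \<sigma>)"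

definition reparametrize ::
    "(int^'d \<Rightarrow> real^'d \<Rightarrow> real) \<Rightarrow> (real^'d \<Rightarrow> real^'d) \<Rightarrow> (int^'d \<Rightarrow> real^'d \<Rightarrow> real)" where
  "reparametrize \<beta> \<psi> = (\<lambda>a. \<beta> a \<circ> \<psi>)"

text \<open>The denominator may vanish at some points of \<open>S\<close>. For \<open>S = \<Delta>\<close> of full dimension and
  \<open>f\<close> continuous, \<open>f\<close> is still determined there by continuity.\<close>

definition rational_on :: "(real^'d) set \<Rightarrow> (real^'d \<Rightarrow> real) \<Rightarrow> bool" where
  "rational_on S f \<longleftrightarrow>
     (\<exists>p q. real_polynomial_function p \<and> real_polynomial_function q \<and>
            (\<exists>x\<in>S. q x \<noteq> 0) \<and> (\<forall>x\<in>S. q x \<noteq> 0 \<longrightarrow> f x = p x / q x))"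

definition rational_linear_precision ::
    "(int^'d) set \<Rightarrow> (int^'d \<Rightarrow> real^'d \<Rightarrow> real) \<Rightarrow> bool" where
  "rational_linear_precision A \<beta> \<longleftrightarrow>
     proper_patch A \<beta> \<and>
     (\<exists>\<psi> \<psi>'. homeomorphism (Delta A) (Delta A) \<psi> \<psi>' \<and>
        linear_precision A (reparametrize \<beta> \<psi>) \<and>
        (\<forall>a\<in>A. rational_on (Delta A) (normalized A (reparametrize \<beta> \<psi>) a)))"


section \<open>Projective spaces\<close>

text \<open>The point \<open>[v]\<close> with homogeneous coordinates \<open>v\<close>, as the set of nonzero multiples of \<open>v\<close>
  (meant for \<open>v \<noteq> 0\<close>).\<close>

definition proj_pt :: "('i \<Rightarrow> 'k::field) \<Rightarrow> ('i \<Rightarrow> 'k) set" where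
  "proj_pt v = {(\<lambda>i. c * v i) | c. c \<noteq> 0}"

text \<open>Coordinate vectors indexed by \<open>A\<close> are functions vanishing off \<open>A\<close>.\<close>

definition punctured :: "'i set \<Rightarrow> ('i \<Rightarrow> 'k::field) set" where
  "punctured A = {v. v \<noteq> (\<lambda>_. 0) \<and> (\<forall>i. i \<notin> A \<longrightarrow> v i = 0)}"

definition RP_topology :: "'i set \<Rightarrow> ('i \<Rightarrow> real) set topology" where
  "RP_topology A = topology (\<lambda>U. U \<subseteq> proj_pt ` punctured A \<and>
     openin (top_of_set (punctured A)) {v \<in> punctured A. proj_pt v \<in> U})"

lemma openin_RP_topology:
  fixes A :: "'i set" and U :: "('i \<Rightarrow> real) set set"
  shows "openin (RP_topology A) U \<longleftrightarrow>
     U \<subseteq> proj_pt ` punctured A \<and>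
     openin (top_of_set (punctured A)) {v \<in> punctured A. proj_pt v \<in> U}"
proof -
  let ?P = "\<lambda>U :: ('i \<Rightarrow> real) set set. U \<subseteq> proj_pt ` punctured A \<and>
     openin (top_of_set (punctured A)) {v \<in> punctured A. proj_pt v \<in> U}"
  have "istopology ?P"
    unfolding istopology_def
  proof (intro conjI allI impI)
    fix S T :: "('i \<Rightarrow> real) set set" assume S: "?P S" and T: "?P T"
    show "S \<inter> T \<subseteq> proj_pt ` punctured A" using S by blast
    have eq: "{v \<in> punctured A. proj_pt v \<in> S \<inter> T} =
        {v \<in> punctured A. proj_pt v \<in> S} \<inter> {v \<in> punctured A. proj_pt v \<in> T}" by blast
    then show "openin (top_of_set (punctured A)) {v \<in> punctured A. proj_pt v \<in> S \<inter> T}"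
      unfolding eq using S T by (intro openin_Int) (elim conjE, assumption)+
  next
    fix K :: "('i \<Rightarrow> real) set set set" assume K: "\<forall>S\<in>K. ?P S"
    show "\<Union>K \<subseteq> proj_pt ` punctured A" using K by blast
    have eq: "{v \<in> punctured A. proj_pt v \<in> \<Union>K} =
        (\<Union>S\<in>K. {v \<in> punctured A. proj_pt v \<in> S})" by blast
    show "openin (top_of_set (punctured A)) {v \<in> punctured A. proj_pt v \<in> \<Union>K}"
      unfolding eq by (rule openin_Union) (use K in blast)
  qed
  then show ?thesis
    unfolding RP_topology_def by (subst topology_inverse') (assumption, rule refl)
qed

definition on_index :: "'i set \<Rightarrow> ('i \<Rightarrow> 'k::zero) \<Rightarrow> ('i \<Rightarrow> 'k)" where
  "on_index A v = (\<lambda>i. if i \<in> A then v i else 0)"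


section \<open>Toric patches\<close>

definition monom_real :: "int^'d \<Rightarrow> real^'d \<Rightarrow> real" where
  "monom_real a x = (\<Prod>i\<in>UNIV. (x $ i) powi (a $ i))"

definition X_toric :: "(int^'d) set \<Rightarrow> (int^'d \<Rightarrow> real) \<Rightarrow> (int^'d \<Rightarrow> real) set set" where
  "X_toric A w = RP_topology A closure_of
     ((\<lambda>x. proj_pt (on_index A (\<lambda>a. w a * monom_real a x))) ` {x. \<forall>i. 0 < x $ i})"

definition toric_patch ::
    "(int^'d) set \<Rightarrow> (int^'d \<Rightarrow> real) \<Rightarrow> (int^'d \<Rightarrow> real^'d \<Rightarrow> real) \<Rightarrow> bool" where
  "toric_patch A w \<beta> \<longleftrightarrow>
     patch A \<beta> \<and> (\<lambda>x. proj_pt (on_index A (\<lambda>a. \<beta> a x))) ` Delta A = X_toric A w"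


section \<open>Rational maps of complex projective space\<close>

inductive complex_poly_fun :: "(('i \<Rightarrow> complex) \<Rightarrow> complex) \<Rightarrow> bool" where
  const: "complex_poly_fun (\<lambda>x. c)"
| coord: "complex_poly_fun (\<lambda>x. x i)"
| add: "complex_poly_fun p \<Longrightarrow> complex_poly_fun q \<Longrightarrow> complex_poly_fun (\<lambda>x. p x + q x)"
| mult: "complex_poly_fun p \<Longrightarrow> complex_poly_fun q \<Longrightarrow> complex_poly_fun (\<lambda>x. p x * q x)"

definition homogeneous_poly :: "nat \<Rightarrow> (('i \<Rightarrow> complex) \<Rightarrow> complex) \<Rightarrow> bool" where
  "homogeneous_poly m p \<longleftrightarrow>
     complex_poly_fun p \<and> (\<forall>c x. p (\<lambda>i. c * x i) = c ^ m * p x)"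

text \<open>The partial map of projective space given on coordinates \<open>x \<in> U\<close> by \<open>[x] \<mapsto> [\<Phi> x]\<close>,
  undefined where \<open>\<Phi> x = 0\<close>. It is independent of the chosen representative when \<open>U\<close> is
  invariant under scaling and \<open>\<Phi>\<close> is homogeneous on \<open>U\<close>.\<close>

definition induced_map ::
    "('i \<Rightarrow> complex) set \<Rightarrow> (('i \<Rightarrow> complex) \<Rightarrow> ('i \<Rightarrow> complex)) \<Rightarrow>
     ('i \<Rightarrow> complex) set \<rightharpoonup> ('i \<Rightarrow> complex) set" where
  "induced_map U \<Phi> p =
     (if p \<in> proj_pt ` {x \<in> U. x \<noteq> (\<lambda>_. 0) \<and> \<Phi> x \<noteq> (\<lambda>_. 0)}
      then Some (proj_pt (\<Phi> (SOME x. x \<in> p))) else None)"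

text \<open>A rational map is a partial map given by homogeneous polynomials of one degree. Only a
  nonempty Zariski open part of the domain need be recorded; it is cut out by \<open>q \<noteq> 0\<close>.\<close>

definition rational_map :: "(('i \<Rightarrow> complex) set \<rightharpoonup> ('i \<Rightarrow> complex) set) \<Rightarrow> bool" where
  "rational_map \<phi> \<longleftrightarrow>
     (\<exists>q P k m. homogeneous_poly k q \<and> (\<forall>j. homogeneous_poly m (\<lambda>x. P x j)) \<and>
        \<phi> = induced_map {x. q x \<noteq> 0} P) \<and> dom \<phi> \<noteq> {}"

text \<open>The composites are required to be defined somewhere (hence on a dense open set), which
  excludes vacuous inverses of non-dominant maps.\<close>

definition birational_isomorphism ::
    "(('i \<Rightarrow> complex) set \<rightharpoonup> ('i \<Rightarrow> complex) set) \<Rightarrow> bool" where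
  "birational_isomorphism \<phi> \<longleftrightarrow>
     rational_map \<phi> \<and>
     (\<exists>\<gamma>. rational_map \<gamma> \<and>
        dom (\<gamma> \<circ>\<^sub>m \<phi>) \<noteq> {} \<and> (\<forall>p \<in> dom (\<gamma> \<circ>\<^sub>m \<phi>). (\<gamma> \<circ>\<^sub>m \<phi>) p = Some p) \<and>
        dom (\<phi> \<circ>\<^sub>m \<gamma>) \<noteq> {} \<and> (\<forall>p \<in> dom (\<phi> \<circ>\<^sub>m \<gamma>). (\<phi> \<circ>\<^sub>m \<gamma>) p = Some p))"


section \<open>The toric derivative\<close>

text \<open>The variables \<open>x\<^sub>0, x\<^sub>1, \<dots>, x\<^sub>d\<close> are indexed by \<open>'d option\<close>: \<open>x None\<close> is the homogenizing
  variable \<open>x\<^sub>0\<close>. Exponents in \<open>\<A>\<close> may be negative.\<close>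

definition F_hom :: "(int^'d) set \<Rightarrow> (int^'d \<Rightarrow> real) \<Rightarrow> ('d option \<Rightarrow> complex) \<Rightarrow> complex" where
  "F_hom A w x = (\<Sum>a\<in>A. of_real (w a) * x None powi (max_deg A - total_deg a) *
                          (\<Prod>i\<in>UNIV. x (Some i) powi (a $ i)))"

definition partial_deriv ::
    "'i \<Rightarrow> (('i \<Rightarrow> complex) \<Rightarrow> complex) \<Rightarrow> ('i \<Rightarrow> complex) \<Rightarrow> complex" where
  "partial_deriv j F x = deriv (\<lambda>t. F (x(j := t))) (x j)"

text \<open>As \<open>F\<close> is a Laurent polynomial in general, the map is recorded on the torus where no
  coordinate vanishes; this determines it as a rational map.\<close>

definition D_torus ::
    "(('i \<Rightarrow> complex) \<Rightarrow> complex) \<Rightarrow> ('i \<Rightarrow> complex) set \<rightharpoonup> ('i \<Rightarrow> complex) set" where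
  "D_torus F = induced_map {x. \<forall>j. x j \<noteq> 0} (\<lambda>x j. x j * partial_deriv j F x)"

end

theory Submission
  imports Defs
begin

text \<open>
  In coordinates \<open>t = exp u\<close> the normalized monomials \<open>w\<^sub>a t\<^sup>a / f(t)\<close> form a Gibbs measure on \<open>A\<close>, and
  its barycenter, a point of \<open>\<Delta>\<close>, is the toric derivative: by Euler's relation
  \<open>\<Sum>\<^sub>j x\<^sub>j \<partial>F/\<partial>x\<^sub>j = n F\<close> with \<open>n \<noteq> 0\<close>, a linear change of coordinates turns \<open>D\<^sub>t\<^sub>o\<^sub>r\<^sub>u\<^sub>s F\<close> into the
  barycenter map in the affine chart \<open>t = x / x\<^sub>0\<close>. The barycenter map is a homeomorphism from the
  closure of the Gibbs measures, which represents \<open>X\<^sub>A\<^sub>,\<^sub>w\<close>, onto \<open>\<Delta>\<close>. Hence a toric patch with linear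
  precision is the inverse of this homeomorphism, whatever the patch was. It is a rational
  function of the point of \<open>\<Delta>\<close> if and only if \<open>t\<close> is, as primitivity makes each \<open>t\<^sub>i\<close> a Laurent
  monomial in the \<open>\<beta>\<^sub>a / w\<^sub>a\<close> of total degree \<open>0\<close>. Identities that hold on the positive real points, or
  on the cone over the interior of \<open>\<Delta>\<close>, extend to all complex points because these sets are
  Zariski dense.
\<close>

section \<open>The barycenter map on Gibbs measures\<close>

text \<open>Logarithmic coordinates are chosen because \<open>ln (partition_fun u)\<close> is convex
  in \<open>u\<close>: its gradient is the barycenter and its Hessian the covariance matrix, so the
  homeomorphism and its smoothness come from elementary convexity. Smoothness matters because the
  existential half of the theorem needs one toric patch known to be proper; the blending functions
  \<open>precise\<close> serve as that patch, and a patch has to be infinitely differentiable in the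
  interior of the polytope. Three mismatches shape the algebra. The toric derivative lives in
  homogeneous coordinates, barycenters in affine ones; the hyperplane of coordinate sum
  \<open>n\<close> in the target links them. Rational maps are partial, so equality of points is
  stated as vanishing 2 x 2 minors and multiplied by a polynomial that vanishes wherever a
  denominator does; only then does density apply. Finally, an inverse may have complex coefficients,
  while blending functions are quotients of real polynomials.\<close>

locale weighted_exponents =
  fixes A :: "(int^'d) set" and w :: "int^'d \<Rightarrow> real"
  assumes finite_A: "finite A"
    and primitive_A: "primitive A"
    and w_pos: "a \<in> A \<Longrightarrow> 0 < w a"
begin

definition partition_fun :: "real^'d \<Rightarrow> real" where
  "partition_fun u = (\<Sum>a\<in>A. w a * exp (real_vec a \<bullet> u))"

text \<open>Values off \<open>A\<close> are 0, so that Gibbs measures are coordinate vectors in the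
  sense of \<open>punctured A\<close> and their closure in the space of all functions is the one in
  the finite-dimensional space of functions on \<open>A\<close>.\<close>

definition gibbs :: "real^'d \<Rightarrow> int^'d \<Rightarrow> real" where
  "gibbs u = on_index A (\<lambda>a. w a * exp (real_vec a \<bullet> u) / partition_fun u)"

definition barycenter :: "(int^'d \<Rightarrow> real) \<Rightarrow> real^'d" where
  "barycenter p = (\<Sum>a\<in>A. p a *\<^sub>R real_vec a)"

definition gibbs_closure :: "(int^'d \<Rightarrow> real) set" where
  "gibbs_closure = closure (range gibbs)"

lemma A_nonempty: "A \<noteq> {}"
  using primitive_A unfolding primitive_def by (metis sum.empty zero_neq_one)

lemma partition_fun_pos: "0 < partition_fun u"
  unfolding partition_fun_def by (intro sum_pos) (auto simp: finite_A A_nonempty w_pos)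

lemma gibbs_in: "a \<in> A \<Longrightarrow> gibbs u a = w a * exp (real_vec a \<bullet> u) / partition_fun u"
  by (simp add: gibbs_def on_index_def)

lemma gibbs_pos: "a \<in> A \<Longrightarrow> 0 < gibbs u a"
  by (simp add: gibbs_in w_pos partition_fun_pos)

lemma sum_gibbs: "(\<Sum>a\<in>A. gibbs u a) = 1"
proof -
  have "(\<Sum>a\<in>A. gibbs u a) = (\<Sum>a\<in>A. w a * exp (real_vec a \<bullet> u)) / partition_fun u"
    unfolding sum_divide_distrib by (intro sum.cong) (auto simp: gibbs_in)
  then show ?thesis
    using partition_fun_pos[of u] by (simp add: partition_fun_def[symmetric])
qed

lemma ln_gibbs: "a \<in> A \<Longrightarrow> ln (gibbs u a) = ln (w a) + real_vec a \<bullet> u - ln (partition_fun u)"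
  using w_pos[of a] partition_fun_pos[of u] by (simp add: gibbs_in ln_div ln_mult)

lemma gibbs_closure_properties:
  assumes "p \<in> gibbs_closure"
  shows "0 \<le> p a" and "a \<notin> A \<Longrightarrow> p a = 0" and "(\<Sum>a\<in>A. p a) = 1"
proof -
  have cont: "continuous_on UNIV (\<lambda>p::int^'d \<Rightarrow> real. p b)" for b
    by (rule continuous_on_product_coordinates)
  have "closed {p::int^'d \<Rightarrow> real. 0 \<le> p a}"
    by (intro closed_Collect_le cont continuous_on_const)
  moreover have "range gibbs \<subseteq> {p. 0 \<le> p a}"
    by (auto simp: gibbs_def on_index_def less_imp_le w_pos partition_fun_pos)
  ultimately show "0 \<le> p a"
    using assms closure_minimal unfolding gibbs_closure_def by blast
  have "closed {p::int^'d \<Rightarrow> real. (\<Sum>a\<in>A. p a) = 1}"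
    by (intro closed_Collect_eq cont continuous_on_const continuous_on_sum)
  moreover have "range gibbs \<subseteq> {p. (\<Sum>a\<in>A. p a) = 1}"
    using sum_gibbs by auto
  ultimately show "(\<Sum>a\<in>A. p a) = 1"
    using assms closure_minimal unfolding gibbs_closure_def by blast
  show "p a = 0" if "a \<notin> A"
  proof -
    have "closed {p::int^'d \<Rightarrow> real. p a = 0}"
      by (intro closed_Collect_eq cont continuous_on_const)
    moreover have "range gibbs \<subseteq> {p. p a = 0}"
      using that by (auto simp: gibbs_def on_index_def)
    ultimately show ?thesis
      using assms closure_minimal unfolding gibbs_closure_def by blast
  qed
qed

lemma gibbs_in_closure: "gibbs u \<in> gibbs_closure"
  unfolding gibbs_closure_def by (rule subsetD[OF closure_subset]) simp

lemma gibbs_closure_le_1: "p \<in> gibbs_closure \<Longrightarrow> p a \<le> 1"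
  using gibbs_closure_properties[of p] member_le_sum[of a A p] finite_A
  by (metis DiffD1 zero_le_one)

text \<open>The index type is infinite, so boundedness is not enough; the closed set lies in the
  cube of functions into [0,1], which is compact by Tychonoff.\<close>

lemma compact_gibbs_closure: "compact gibbs_closure"
proof -
  define S :: "(int^'d \<Rightarrow> real) set" where "S = PiE UNIV (\<lambda>_. {0..1})"
  have "compactin (product_topology (\<lambda>_::int^'d. euclideanreal) UNIV) S"
    unfolding S_def compactin_PiE by simp
  then have "compact S"
    by (simp add: euclidean_product_topology)
  moreover have "gibbs_closure \<subseteq> S"
    unfolding S_def using gibbs_closure_properties(1) gibbs_closure_le_1 by auto
  moreover have "closed gibbs_closure"
    by (simp add: gibbs_closure_def)
  ultimately show ?thesis
    by (metis compact_Int_closed inf.absorb_iff2)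
qed

lemma continuous_barycenter: "continuous_on S barycenter"
  unfolding barycenter_def
  by (intro continuous_on_sum continuous_on_scaleR continuous_on_const)
     (rule continuous_on_subset[OF continuous_on_product_coordinates], simp)

text \<open>If \<open>p \<noteq> p'\<close> had the same barycenter, then \<open>\<Sum>\<^sub>a (p a - p' a) (ln q a - ln q' a)\<close> would vanish
  for all Gibbs points \<open>q, q'\<close>, because \<open>ln (q a / q' a)\<close> is an affine function of \<open>a\<close>; but all
  its terms are nonnegative, some positive, once \<open>q, q'\<close> are close enough to \<open>p, p'\<close>.\<close>

lemma inj_on_barycenter: "inj_on barycenter gibbs_closure"
proof (rule inj_onI, rule ccontr)
  fix p p' assume p: "p \<in> gibbs_closure" and p': "p' \<in> gibbs_closure"
    and eq: "barycenter p = barycenter p'" and "p \<noteq> p'"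
  then obtain a0 where "p a0 \<noteq> p' a0" by blast
  then have a0: "a0 \<in> A" "p a0 \<noteq> p' a0"
    using gibbs_closure_properties(2)[OF p, of a0] gibbs_closure_properties(2)[OF p', of a0]
    by metis+
  \<comment> \<open>Points of the closure may have zero entries, where \<open>ln\<close> is useless;
    hence the passage to nearby Gibbs measures, whose entries on \<open>A\<close> are
    positive.\<close>
  have approx: "\<exists>u. \<forall>a\<in>A. \<bar>gibbs u a - q a\<bar> < \<epsilon> a"
    if "q \<in> gibbs_closure" "\<forall>a\<in>A. 0 < \<epsilon> a" for q and \<epsilon> :: "int^'d \<Rightarrow> real"
  proof -
    have "open (\<Inter>a\<in>A. {r::int^'d \<Rightarrow> real. \<bar>r a - q a\<bar> < \<epsilon> a})"
      by (intro open_INT finite_A ballI open_Collect_less continuous_intros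
          continuous_on_product_coordinates)
    moreover have "q \<in> (\<Inter>a\<in>A. {r. \<bar>r a - q a\<bar> < \<epsilon> a})"
      using that(2) by auto
    ultimately have "(\<Inter>a\<in>A. {r. \<bar>r a - q a\<bar> < \<epsilon> a}) \<inter> range gibbs \<noteq> {}"
      using that(1) open_Int_closure_eq_empty[of "\<Inter>a\<in>A. {r. \<bar>r a - q a\<bar> < \<epsilon> a}" "range gibbs"]
      unfolding gibbs_closure_def by blast
    then show ?thesis by auto
  qed
  \<comment> \<open>Half the gap forces \<open>gibbs u a\<close> and \<open>gibbs v a\<close> into
    the same order as \<open>p a\<close> and \<open>p' a\<close>. Without a gap the weight
    \<open>r a\<close> is 0 and any tolerance will do.\<close>
  define \<epsilon> where "\<epsilon> a = (if p a = p' a then 1 else \<bar>p a - p' a\<bar> / 2)" for a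
  have \<epsilon>: "\<forall>a\<in>A. 0 < \<epsilon> a" by (auto simp: \<epsilon>_def)
  obtain u where u: "\<forall>a\<in>A. \<bar>gibbs u a - p a\<bar> < \<epsilon> a" using approx[OF p \<epsilon>] by blast
  obtain v where v: "\<forall>a\<in>A. \<bar>gibbs v a - p' a\<bar> < \<epsilon> a" using approx[OF p' \<epsilon>] by blast
  define r where "r a = p a - p' a" for a
  have pos: "0 < r a * (ln (gibbs u a) - ln (gibbs v a))" if a: "a \<in> A" "r a \<noteq> 0" for a
  proof (cases "p a > p' a")
    case True
    then have "gibbs v a < gibbs u a"
      using u[rule_format, OF a(1)] v[rule_format, OF a(1)]
      by (simp add: \<epsilon>_def abs_if split: if_splits)
    then show ?thesis
      using True gibbs_pos[OF a(1), of u] gibbs_pos[OF a(1), of v] by (simp add: r_def)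
  next
    case False
    then have "p a < p' a" using a(2) by (simp add: r_def)
    then have "gibbs u a < gibbs v a"
      using u[rule_format, OF a(1)] v[rule_format, OF a(1)]
      by (simp add: \<epsilon>_def abs_if split: if_splits)
    then show ?thesis
      using \<open>p a < p' a\<close> gibbs_pos[OF a(1), of u] gibbs_pos[OF a(1), of v]
      by (simp add: r_def mult_neg_neg)
  qed
  have "0 < (\<Sum>a\<in>A. r a * (ln (gibbs u a) - ln (gibbs v a)))"
  proof (rule sum_pos2[OF finite_A a0(1)])
    show "0 < r a0 * (ln (gibbs u a0) - ln (gibbs v a0))"
      using pos[OF a0(1)] a0(2) by (simp add: r_def)
    show "0 \<le> r a * (ln (gibbs u a) - ln (gibbs v a))" if "a \<in> A" for a
      using pos[OF that] by (cases "r a = 0") auto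
  qed
  also have "(\<Sum>a\<in>A. r a * (ln (gibbs u a) - ln (gibbs v a)))
     = (\<Sum>a\<in>A. (r a *\<^sub>R real_vec a) \<bullet> (u - v) + r a * (ln (partition_fun v) - ln (partition_fun u)))"
    by (intro sum.cong) (auto simp: ln_gibbs inner_diff_right algebra_simps)
  also have "\<dots> = (barycenter p - barycenter p') \<bullet> (u - v)
      + (\<Sum>a\<in>A. r a) * (ln (partition_fun v) - ln (partition_fun u))"
    by (simp add: sum.distrib inner_sum_left sum_distrib_right[symmetric]
        barycenter_def r_def scaleR_left_diff_distrib sum_subtractf inner_diff_left)
  also have "\<dots> = 0"
    using eq gibbs_closure_properties(3)[OF p] gibbs_closure_properties(3)[OF p']
    by (simp add: r_def sum_subtractf)
  finally show False by simp
qed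

text \<open>Integer affine combinations preserve the common value \<open>b\<close>, so by
  primitivity it is taken at every lattice point; 0 and the unit vectors give \<open>b = 0\<close>
  and \<open>c = 0\<close>. This yields both the full dimension of the polytope and the
  invertibility of the covariance matrix.\<close>

lemma real_vec_affine_const:
  assumes "\<And>a. a \<in> A \<Longrightarrow> c \<bullet> real_vec a = b"
  shows "c = 0"
proof -
  have const: "c \<bullet> real_vec z = b" for z :: "int^'d"
  proof -
    obtain k :: "int^'d \<Rightarrow> int" where k: "(\<Sum>a\<in>A. k a) = 1" "z = (\<Sum>a\<in>A. k a *s a)"
      using primitive_A unfolding primitive_def by blast
    have "real_vec z = (\<Sum>a\<in>A. real_of_int (k a) *\<^sub>R real_vec a)"
      by (simp add: k(2) real_vec_def vec_eq_iff)
    then have "c \<bullet> real_vec z = (\<Sum>a\<in>A. real_of_int (k a) * b)"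
      by (simp add: inner_sum_right assms)
    also have "\<dots> = b"
      using k(1) by (metis mult_1 of_int_1 of_int_sum sum_distrib_right)
    finally show ?thesis .
  qed
  have "real_vec 0 = (0::real^'d)" by (simp add: real_vec_def vec_eq_iff)
  then have "b = 0" using const[of 0] by simp
  moreover have axis: "real_vec (axis i 1) = (axis i 1 :: real^'d)" for i
    by (simp add: real_vec_def vec_eq_iff axis_def)
  ultimately have "c $ i = 0" for i
    using const[of "axis i 1"] unfolding axis by (simp add: inner_axis)
  then show "c = 0" by (simp add: vec_eq_iff)
qed

lemma interior_Delta_nonempty: "interior (Delta A) \<noteq> {}"
proof
  assume "interior (Delta A) = {}"
  then obtain c b where cb: "c \<noteq> 0" "Delta A \<subseteq> {x. c \<bullet> x = b}"
    by (rule empty_interior_subset_hyperplane[of "Delta A", rotated])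
       (simp_all add: Delta_def)
  have "real_vec a \<in> Delta A" if "a \<in> A" for a
    using that unfolding Delta_def by (simp add: hull_inc)
  then have "c \<bullet> real_vec a = b" if "a \<in> A" for a
    using cb(2) that by blast
  then show False using real_vec_affine_const cb(1) by blast
qed

lemma closure_interior_Delta: "closure (interior (Delta A)) = Delta A"
proof -
  have "closure (interior (Delta A)) = closure (Delta A)"
    using interior_Delta_nonempty unfolding Delta_def
    by (simp add: convex_closure_interior)
  also have "\<dots> = Delta A"
    unfolding Delta_def
    by (simp add: finite_A compact_convex_hull finite_imp_compact compact_imp_closed)
  finally show ?thesis .
qed

lemma gibbs_closure_barycenter: "p \<in> gibbs_closure \<Longrightarrow> barycenter p \<in> Delta A"
  unfolding barycenter_def Delta_def using gibbs_closure_properties[of p]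
  by (intro convex_sum finite_A convex_convex_hull) (auto intro: hull_inc)

text \<open>The minimum of the convex function \<open>u \<mapsto> \<Sum>\<^sub>a w a * exp ((a - y) \<bullet> u)\<close>, which is proper
  for interior points \<open>y\<close>, is attained at the required \<open>u\<close>.\<close>

lemma gibbs_surj_interior:
  assumes y: "y \<in> interior (Delta A)"
  obtains u where "barycenter (gibbs u) = y"
proof -
  define g where "g u = (\<Sum>a\<in>A. w a * exp ((real_vec a - y) \<bullet> u))" for u
  obtain \<delta> where \<delta>: "\<delta> > 0" "cball y \<delta> \<subseteq> Delta A"
    using y by (meson mem_interior_cball)
  define m where "m = Min (w ` A)"
  have m: "0 < m" "\<And>a. a \<in> A \<Longrightarrow> m \<le> w a"
    using finite_A A_nonempty w_pos by (auto simp: m_def Min_gr_iff)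
  \<comment> \<open>Coercivity of \<open>g\<close>: as the polytope contains a ball of radius
    \<delta> around \<open>y\<close>, in every direction some exponent lies at least \<delta> beyond
    \<open>y\<close>.\<close>
  have lower: "m * exp (\<delta> * norm u) \<le> g u" for u
  proof -
    have "\<exists>a\<in>A. \<delta> * norm u \<le> (real_vec a - y) \<bullet> u"
    proof (rule ccontr)
      assume "\<not> ?thesis"
      then have "real_vec ` A \<subseteq> {x. u \<bullet> x < \<delta> * norm u + u \<bullet> y}"
        by (auto simp: inner_commute not_le) (metis inner_diff_right diff_less_eq)
      then have "Delta A \<subseteq> {x. u \<bullet> x < \<delta> * norm u + u \<bullet> y}"
        unfolding Delta_def by (rule hull_minimal) (rule convex_halfspace_lt)
      \<comment> \<open>The farthest point of the ball in direction \<open>u\<close>, which the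
        assumed open half-space would exclude. For \<open>u = 0\<close> division by zero makes it
        \<open>y\<close>, and the contradiction is 0 < 0.\<close>
      moreover have "y + (\<delta> / norm u) *\<^sub>R u \<in> cball y \<delta>"
        using \<delta>(1) by (cases "u = 0") (auto simp: dist_norm)
      ultimately have "u \<bullet> (y + (\<delta> / norm u) *\<^sub>R u) < \<delta> * norm u + u \<bullet> y"
        using \<delta>(2) by blast
      then show False
        by (cases "u = 0") (auto simp: inner_add_right dot_square_norm power2_eq_square)
    qed
    then obtain a where a: "a \<in> A" "\<delta> * norm u \<le> (real_vec a - y) \<bullet> u" by blast
    have "m * exp (\<delta> * norm u) \<le> w a * exp ((real_vec a - y) \<bullet> u)"
      using a m(1) m(2)[OF a(1)] by (intro mult_mono) auto
    also have "\<dots> \<le> g u"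
      unfolding g_def using a(1) finite_A w_pos
      by (intro member_le_sum) (auto simp: less_imp_le)
    finally show ?thesis .
  qed
  \<comment> \<open>Solves \<open>m * \<delta> * R = g 0\<close>. Since \<open>exp t\<close> is at
    least \<open>t\<close>, \<open>g\<close> is at least \<open>g 0\<close> outside this ball, so
    its minimum on the ball is global.\<close>
  define R where "R = g 0 / (m * \<delta>)"
  have "0 < g 0"
    unfolding g_def by (intro sum_pos) (auto simp: finite_A A_nonempty w_pos)
  then have R: "R > 0" using m(1) \<delta>(1) by (simp add: R_def)
  have cont: "continuous_on (cball 0 R) g"
    unfolding g_def by (intro continuous_intros)
  obtain u where u: "u \<in> cball 0 R" "\<And>v. v \<in> cball 0 R \<Longrightarrow> g u \<le> g v"
    using continuous_attains_inf[OF compact_cball _ cont] R by fastforce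
  have min: "g u \<le> g v" for v
  proof (cases "v \<in> cball 0 R")
    case False
    then have v: "R < norm v" by simp
    have "g u \<le> g 0" using u(2)[of 0] R by simp
    also have "g 0 = m * (\<delta> * R)" using m(1) \<delta>(1) by (simp add: R_def)
    also have "\<dots> \<le> m * exp (\<delta> * norm v)"
    proof (rule mult_left_mono)
      have "\<delta> * R \<le> \<delta> * norm v" using v \<delta>(1) by simp
      also have "\<dots> \<le> exp (\<delta> * norm v)"
        using exp_ge_add_one_self[of "\<delta> * norm v"] by linarith
      finally show "\<delta> * R \<le> exp (\<delta> * norm v)" .
    qed (use m(1) in simp)
    also have "\<dots> \<le> g v" by (rule lower)
    finally show ?thesis .
  qed (use u in simp)
  define D where "D h = (\<Sum>a\<in>A. w a * (exp ((real_vec a - y) \<bullet> u) * ((real_vec a - y) \<bullet> h)))" for h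
  have "(g has_derivative D) (at u)"
    unfolding g_def D_def by (auto intro!: derivative_eq_intros simp: mult_ac)
  then have "D = (\<lambda>h. 0)"
    using differential_zero_maxmin[OF UNIV_I open_UNIV] min by blast
  \<comment> \<open>The gradient of \<open>g\<close> at the minimum; it is a positive multiple of
    \<open>barycenter (gibbs u) - y\<close>.\<close>
  define s where "s = (\<Sum>a\<in>A. (w a * exp ((real_vec a - y) \<bullet> u)) *\<^sub>R (real_vec a - y))"
  have "D h = s \<bullet> h" for h
    by (simp add: D_def s_def inner_sum_left mult.assoc)
  then have "s \<bullet> s = 0" using \<open>D = (\<lambda>h. 0)\<close> by metis
  then have s0: "s = 0" by simp
  have "barycenter (gibbs u) - y = (\<Sum>a\<in>A. gibbs u a *\<^sub>R (real_vec a - y))"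
    by (simp add: barycenter_def scaleR_right_diff_distrib sum_subtractf
        scaleR_sum_left[symmetric] sum_gibbs)
  also have "\<dots> = (\<Sum>a\<in>A. (exp (y \<bullet> u) / partition_fun u) *\<^sub>R
      ((w a * exp ((real_vec a - y) \<bullet> u)) *\<^sub>R (real_vec a - y)))"
    by (intro sum.cong) (auto simp: gibbs_in inner_diff_left exp_diff)
  also have "\<dots> = (exp (y \<bullet> u) / partition_fun u) *\<^sub>R s"
    by (simp only: s_def scaleR_sum_right)
  finally have "barycenter (gibbs u) = y" using s0 by simp
  then show ?thesis by (rule that)
qed

text \<open>The image is compact, hence closed, and contains the interior, whose closure is the
  whole polytope; boundary points need no separate construction.\<close>

lemma barycenter_image: "barycenter ` gibbs_closure = Delta A"
proof
  show "barycenter ` gibbs_closure \<subseteq> Delta A"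
    using gibbs_closure_barycenter by blast
  have "interior (Delta A) \<subseteq> barycenter ` gibbs_closure"
    using gibbs_surj_interior gibbs_in_closure by (metis image_eqI subsetI)
  moreover have "closed (barycenter ` gibbs_closure)"
    by (intro compact_imp_closed compact_continuous_image continuous_barycenter
        compact_gibbs_closure)
  ultimately have "closure (interior (Delta A)) \<subseteq> barycenter ` gibbs_closure"
    by (rule closure_minimal)
  then show "Delta A \<subseteq> barycenter ` gibbs_closure"
    by (simp add: closure_interior_Delta)
qed

text \<open>The blending functions of the toric patch with linear precision, indexed by the second argument.\<close>

definition precise :: "real^'d \<Rightarrow> int^'d \<Rightarrow> real" where
  "precise = the_inv_into gibbs_closure barycenter"

lemma precise_in: "y \<in> Delta A \<Longrightarrow> precise y \<in> gibbs_closure"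
  unfolding precise_def using the_inv_into_into[OF inj_on_barycenter] barycenter_image by blast

lemma barycenter_precise: "y \<in> Delta A \<Longrightarrow> barycenter (precise y) = y"
  unfolding precise_def using f_the_inv_into_f[OF inj_on_barycenter] barycenter_image by blast

lemma precise_barycenter: "p \<in> gibbs_closure \<Longrightarrow> precise (barycenter p) = p"
  unfolding precise_def by (rule the_inv_into_f_f[OF inj_on_barycenter])

lemma precise_image: "precise ` Delta A = gibbs_closure"
  using precise_in precise_barycenter gibbs_closure_barycenter by force

lemma continuous_precise: "continuous_on (Delta A) precise"
proof -
  obtain g where g: "homeomorphism gibbs_closure (Delta A) barycenter g"
    using homeomorphism_compact[OF compact_gibbs_closure continuous_barycenter barycenter_image
        inj_on_barycenter] by blast
  then have "precise y = g y" if "y \<in> Delta A" for y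
    using that precise_barycenter[of "g y"] homeomorphism_apply2[OF g that]
      homeomorphism_image2[OF g] by auto
  then show ?thesis
    using homeomorphism_cont2[OF g] by (simp cong: continuous_on_cong)
qed

lemma continuous_precise_component: "continuous_on (Delta A) (\<lambda>y. precise y a)"
  by (rule continuous_on_product_then_coordinatewise[OF continuous_precise])

end

section \<open>Smoothness of the inverse barycenter map\<close>

text \<open>At order 0 this is continuity of differentiable functions. The product rule needs it,
  because the derivative of a product contains the undifferentiated factors.\<close>

lemma Ck_on_SucD: "Ck_on (Suc k) U f \<Longrightarrow> Ck_on k U f"
proof (induction k arbitrary: f)
  case 0
  then obtain g where "\<forall>x\<in>U. (f has_derivative (\<lambda>h. \<Sum>i\<in>UNIV. g i x * h $ i)) (at x)"
    by auto
  then show ?case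
    by (auto intro!: continuous_at_imp_continuous_on has_derivative_continuous)
next
  case (Suc k)
  obtain g where g: "\<forall>x\<in>U. (f has_derivative (\<lambda>h. \<Sum>i\<in>UNIV. g i x * h $ i)) (at x)"
    "\<forall>i. Ck_on (Suc k) U (g i)"
    using Suc.prems unfolding Ck_on.simps(2)[of "Suc k"] by blast
  have "\<forall>i. Ck_on k U (g i)"
    using Suc.IH g(2) by blast
  then show ?case
    using g(1) by auto
qed

lemma Ck_on_const: "Ck_on k U (\<lambda>x. c)"
proof (induction k arbitrary: c)
  case (Suc k)
  then show ?case by (auto intro!: exI[of _ "\<lambda>i x. 0"])
qed auto

lemma Ck_on_coord:
  fixes U :: "(real^'d) set"
  shows "Ck_on k U (\<lambda>x. x $ j)"
proof (cases k)
  case (Suc n)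
  have "((\<lambda>x. x $ j) has_derivative (\<lambda>h. \<Sum>i\<in>UNIV. (if i = j then 1 else 0) * h $ i)) (at x)" for x :: "real^'d"
    by (auto simp: if_distrib[of "\<lambda>c. c * _"] sum.delta cong: if_cong
        intro: bounded_linear_imp_has_derivative bounded_linear_vec_nth)
  then show ?thesis
    by (auto simp: Suc Ck_on_const intro!: exI[of _ "\<lambda>i x. if i = j then 1 else 0"])
qed (auto intro: continuous_intros)

lemma Ck_on_add: "Ck_on k U f \<Longrightarrow> Ck_on k U g \<Longrightarrow> Ck_on k U (\<lambda>x. f x + g x)"
proof (induction k arbitrary: f g)
  case (Suc k)
  obtain f' where f': "\<forall>x\<in>U. (f has_derivative (\<lambda>h. \<Sum>i\<in>UNIV. f' i x * h $ i)) (at x)"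
    "\<forall>i. Ck_on k U (f' i)" using Suc.prems(1) by auto
  obtain g' where g': "\<forall>x\<in>U. (g has_derivative (\<lambda>h. \<Sum>i\<in>UNIV. g' i x * h $ i)) (at x)"
    "\<forall>i. Ck_on k U (g' i)" using Suc.prems(2) by auto
  have "((\<lambda>x. f x + g x) has_derivative (\<lambda>h. \<Sum>i\<in>UNIV. (f' i x + g' i x) * h $ i)) (at x)"
    if "x \<in> U" for x
    using has_derivative_add[OF f'(1)[rule_format, OF that] g'(1)[rule_format, OF that]]
    by (simp add: algebra_simps sum.distrib)
  then show ?case
    using Suc.IH f'(2) g'(2) by (auto intro!: exI[of _ "\<lambda>i x. f' i x + g' i x"])
qed (auto intro: continuous_intros)

lemma Ck_on_mult: "Ck_on k U f \<Longrightarrow> Ck_on k U g \<Longrightarrow> Ck_on k U (\<lambda>x. f x * g x)"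
proof (induction k arbitrary: f g)
  case (Suc k)
  obtain f' where f': "\<forall>x\<in>U. (f has_derivative (\<lambda>h. \<Sum>i\<in>UNIV. f' i x * h $ i)) (at x)"
    "\<forall>i. Ck_on k U (f' i)" using Suc.prems(1) by auto
  obtain g' where g': "\<forall>x\<in>U. (g has_derivative (\<lambda>h. \<Sum>i\<in>UNIV. g' i x * h $ i)) (at x)"
    "\<forall>i. Ck_on k U (g' i)" using Suc.prems(2) by auto
  have "((\<lambda>x. f x * g x) has_derivative (\<lambda>h. \<Sum>i\<in>UNIV. (f x * g' i x + f' i x * g x) * h $ i)) (at x)"
    if "x \<in> U" for x
    using has_derivative_mult[OF f'(1)[rule_format, OF that] g'(1)[rule_format, OF that]]
    by (simp add: algebra_simps sum.distrib sum_distrib_left sum_distrib_right)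
  moreover have "Ck_on k U (\<lambda>x. f x * g' i x + f' i x * g x)" for i
    using Suc.IH Ck_on_SucD[OF Suc.prems(1)] Ck_on_SucD[OF Suc.prems(2)] f'(2) g'(2)
    by (intro Ck_on_add) blast+
  ultimately show ?case
    by (auto intro!: exI[of _ "\<lambda>i x. f x * g' i x + f' i x * g x"])
qed (auto intro: continuous_intros)

text \<open>The derivative is a product of \<open>f'\<close> and powers of \<open>inverse f\<close>,
  so the induction hypothesis for the same \<open>f\<close> suffices.\<close>

lemma Ck_on_inverse:
  assumes "\<And>x. x \<in> U \<Longrightarrow> f x \<noteq> 0"
  shows "Ck_on k U f \<Longrightarrow> Ck_on k U (\<lambda>x. inverse (f x))"
proof (induction k)
  case 0
  then show ?case using assms by (auto intro: continuous_intros)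
next
  case (Suc k)
  obtain f' where f': "\<forall>x\<in>U. (f has_derivative (\<lambda>h. \<Sum>i\<in>UNIV. f' i x * h $ i)) (at x)"
    "\<forall>i. Ck_on k U (f' i)" using Suc.prems(1) by auto
  define g where "g i x = -1 * (inverse (f x) * (f' i x * inverse (f x)))" for i x
  have "((\<lambda>x. inverse (f x)) has_derivative (\<lambda>h. \<Sum>i\<in>UNIV. g i x * h $ i)) (at x)"
    if "x \<in> U" for x
    using Deriv.has_derivative_inverse[OF assms f'(1)[rule_format], OF that that]
    by (simp add: g_def algebra_simps sum_distrib_left sum_negf)
  moreover have "Ck_on k U (g i)" for i
    unfolding g_def using Suc.IH Ck_on_SucD[OF Suc.prems(1)] f'(2)
    by (intro Ck_on_mult Ck_on_const) blast+
  ultimately show ?case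
    by (auto intro!: exI[of _ g])
qed

lemma Ck_on_sum: "(\<And>i. i \<in> I \<Longrightarrow> Ck_on k U (f i)) \<Longrightarrow> Ck_on k U (\<lambda>x. \<Sum>i\<in>I. f i x)"
  by (induction I rule: infinite_finite_induct) (auto simp: Ck_on_const intro: Ck_on_add)

lemma Ck_on_prod: "(\<And>i. i \<in> I \<Longrightarrow> Ck_on k U (f i)) \<Longrightarrow> Ck_on k U (\<lambda>x. \<Prod>i\<in>I. f i x)"
  by (induction I rule: infinite_finite_induct) (auto simp: Ck_on_const intro: Ck_on_mult)

lemma Ck_on_det:
  assumes "\<And>i j. Ck_on k U (\<lambda>x. M x $ i $ j)"
  shows "Ck_on k U (\<lambda>x. det (M x))"
  unfolding det_def by (intro Ck_on_sum Ck_on_mult Ck_on_const Ck_on_prod assms)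

section \<open>Derivatives of Gibbs measures and of their barycenters\<close>

context weighted_exponents
begin

text \<open>Subtract the affine combination representing 0 from the one representing the unit
  vector. Coefficient sum 0 means that a common factor of all weights cancels in the corresponding
  Laurent monomial.\<close>

lemma primitive_unit_combinations:
  "\<exists>k :: 'd \<Rightarrow> int^'d \<Rightarrow> int. (\<forall>i. (\<Sum>a\<in>A. k i a) = 0) \<and>
    (\<forall>i j. (\<Sum>a\<in>A. k i a * a $ j) = (if j = i then 1 else 0))"
proof -
  have "\<exists>k. (\<Sum>a\<in>A. k a) = 1 \<and> z = (\<Sum>a\<in>A. k a *s a)" for z
    using primitive_A unfolding primitive_def by blast
  then obtain l where l: "\<And>z. (\<Sum>a\<in>A. l z a) = 1" "\<And>z. z = (\<Sum>a\<in>A. l z a *s a)" by metis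
  have comp: "(\<Sum>a\<in>A. l z a * a $ j) = z $ j" for z j
    using arg_cong[OF l(2)[of z], of "\<lambda>v. v $ j"] by simp
  show ?thesis
  proof (intro exI conjI allI)
    show "(\<Sum>a\<in>A. l (axis i 1) a - l 0 a) = 0" for i
      by (simp add: sum_subtractf l(1))
    show "(\<Sum>a\<in>A. (l (axis i 1) a - l 0 a) * a $ j) = (if j = i then 1 else 0)" for i j
      by (simp add: left_diff_distrib sum_subtractf comp axis_def)
  qed
qed

text \<open>For \<open>y = barycenter p\<close> this is the covariance matrix of the measure
  \<open>p\<close>. With the center as a separate argument, its entries are visibly polynomials in
  \<open>y\<close> and \<open>p\<close>.\<close>

definition covariance :: "real^'d \<Rightarrow> (int^'d \<Rightarrow> real) \<Rightarrow> real^'d^'d" where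
  "covariance y p = (\<chi> i j. \<Sum>a\<in>A. p a * ((real_vec a - y) $ i * (real_vec a - y) $ j))"

lemma covariance_mult: "covariance y p *v h = (\<Sum>a\<in>A. (p a * ((real_vec a - y) \<bullet> h)) *\<^sub>R (real_vec a - y))"
proof -
  have "(covariance y p *v h) $ i = (\<Sum>a\<in>A. (p a * ((real_vec a - y) \<bullet> h)) * (real_vec a - y) $ i)" for i
  proof -
    have "(covariance y p *v h) $ i
        = (\<Sum>j\<in>UNIV. \<Sum>a\<in>A. p a * ((real_vec a - y) $ i * (real_vec a - y) $ j) * h $ j)"
      by (simp add: covariance_def matrix_vector_mult_def sum_distrib_right)
    also have "\<dots> = (\<Sum>a\<in>A. \<Sum>j\<in>UNIV. p a * ((real_vec a - y) $ i * (real_vec a - y) $ j) * h $ j)"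
      by (rule sum.swap)
    also have "\<dots> = (\<Sum>a\<in>A. (p a * ((real_vec a - y) \<bullet> h)) * (real_vec a - y) $ i)"
      by (simp add: inner_vec_def sum_distrib_left sum_distrib_right mult_ac)
    finally show ?thesis .
  qed
  then show ?thesis by (simp add: vec_eq_iff)
qed

text \<open>The quadratic form is a sum of squares with positive weights; if it vanishes at
  \<open>h\<close>, then \<open>h\<close> is constant on the exponents and hence 0.\<close>

lemma det_covariance_nonzero:
  assumes "\<And>a. a \<in> A \<Longrightarrow> 0 < p a"
  shows "det (covariance y p) \<noteq> 0"
proof -
  have "h = 0" if "covariance y p *v h = 0" for h
  proof -
    have "0 = (covariance y p *v h) \<bullet> h" using that by simp
    also have "\<dots> = (\<Sum>a\<in>A. p a * ((real_vec a - y) \<bullet> h)\<^sup>2)"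
      by (simp add: covariance_mult inner_sum_left power2_eq_square mult_ac)
    finally have eq: "(\<Sum>a\<in>A. p a * ((real_vec a - y) \<bullet> h)\<^sup>2) = 0" by simp
    have "h \<bullet> real_vec a = h \<bullet> y" if "a \<in> A" for a
    proof -
      have "p a * ((real_vec a - y) \<bullet> h)\<^sup>2 = 0"
        using sum_nonneg_0[OF finite_A _ eq that] assms by (simp add: less_imp_le)
      then show ?thesis
        using assms[OF that] by (simp add: inner_commute inner_diff_right)
    qed
    then show "h = 0" by (rule real_vec_affine_const)
  qed
  then have "invertible (covariance y p)"
    unfolding invertible_left_inverse matrix_left_invertible_ker by blast
  then show ?thesis by (simp add: invertible_det_nz)
qed

text \<open>Logarithmic derivative: the exponential contributes \<open>real_vec a\<close>, the
  partition function subtracts its mean.\<close>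

lemma gibbs_has_derivative:
  assumes "a \<in> A"
  shows "((\<lambda>u. gibbs u a) has_derivative
    (\<lambda>h. gibbs u a * ((real_vec a - barycenter (gibbs u)) \<bullet> h))) (at u)"
proof -
  have Z: "(partition_fun has_derivative (\<lambda>h. partition_fun u * (barycenter (gibbs u) \<bullet> h))) (at u)"
  proof -
    have "partition_fun u * (barycenter (gibbs u) \<bullet> h)
        = (\<Sum>a\<in>A. w a * (exp (real_vec a \<bullet> u) * (real_vec a \<bullet> h)))" for h
      using partition_fun_pos[of u]
      by (simp add: barycenter_def inner_sum_left sum_distrib_left gibbs_in mult.assoc cong: sum.cong)
    moreover have "(partition_fun has_derivative
        (\<lambda>h. \<Sum>a\<in>A. w a * (exp (real_vec a \<bullet> u) * (real_vec a \<bullet> h)))) (at u)"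
      unfolding partition_fun_def[abs_def] by (auto intro!: derivative_eq_intros simp: mult_ac)
    ultimately show ?thesis by simp
  qed
  have "((\<lambda>u. w a * exp (real_vec a \<bullet> u) / partition_fun u) has_derivative
    (\<lambda>h. gibbs u a * ((real_vec a - barycenter (gibbs u)) \<bullet> h))) (at u)"
    using partition_fun_pos[of u] assms
    by (auto intro!: derivative_eq_intros Z simp: gibbs_in field_simps inner_diff_left)
  then show ?thesis using assms by (simp add: gibbs_in)
qed

lemma barycenter_gibbs_has_derivative:
  "((\<lambda>u. barycenter (gibbs u)) has_derivative
    (\<lambda>h. covariance (barycenter (gibbs u)) (gibbs u) *v h)) (at u)"
proof -
  let ?y = "barycenter (gibbs u)"
  \<comment> \<open>Deviations from the mean average to 0, so the vector \<open>real_vec a\<close>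
    may be replaced by \<open>real_vec a - ?y\<close>, which turns the derivative into the
    covariance.\<close>
  have zero: "(\<Sum>a\<in>A. gibbs u a * ((real_vec a - ?y) \<bullet> h)) = 0" for h
  proof -
    have "(\<Sum>a\<in>A. gibbs u a * ((real_vec a - ?y) \<bullet> h))
        = (\<Sum>a\<in>A. gibbs u a *\<^sub>R real_vec a) \<bullet> h - (\<Sum>a\<in>A. gibbs u a) * (?y \<bullet> h)"
      by (simp add: inner_diff_left right_diff_distrib sum_subtractf inner_sum_left sum_distrib_right)
    then show ?thesis by (simp add: sum_gibbs barycenter_def)
  qed
  have "covariance ?y (gibbs u) *v h
      = (\<Sum>a\<in>A. (gibbs u a * ((real_vec a - ?y) \<bullet> h)) *\<^sub>R real_vec a)" for h
    by (simp add: covariance_mult scaleR_right_diff_distrib sum_subtractf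
        scaleR_sum_left[symmetric] zero)
  moreover have "((\<lambda>u. barycenter (gibbs u)) has_derivative
      (\<lambda>h. \<Sum>a\<in>A. (gibbs u a * ((real_vec a - ?y) \<bullet> h)) *\<^sub>R real_vec a)) (at u)"
    unfolding barycenter_def[of "gibbs _"]
    by (intro has_derivative_sum has_derivative_scaleR_left) (rule gibbs_has_derivative[unfolded barycenter_def])
  ultimately show ?thesis by simp
qed

lemma precise_interior:
  assumes "y \<in> interior (Delta A)"
  obtains u where "precise y = gibbs u" "barycenter (gibbs u) = y"
  using gibbs_surj_interior[OF assms] precise_barycenter gibbs_in_closure by metis

lemma precise_pos: "y \<in> interior (Delta A) \<Longrightarrow> a \<in> A \<Longrightarrow> 0 < precise y a"
  by (metis precise_interior gibbs_pos)

text \<open>Recovers \<open>u\<close> from the logarithms of \<open>gibbs u a / w a\<close>: as the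
  coefficients sum to 0, the constant \<open>c\<close>, in use the logarithm of the partition
  function, drops out.\<close>

lemma unit_combination_inner:
  assumes "(\<Sum>a\<in>A. k a) = (0::int)" "\<And>j. (\<Sum>a\<in>A. k a * a $ j) = (if j = i then 1 else 0)"
  shows "(\<Sum>a\<in>A. real_of_int (k a) * (real_vec a \<bullet> u - c)) = u $ i"
proof -
  have "(\<Sum>a\<in>A. real_of_int (k a) * (real_vec a \<bullet> u - c))
      = (\<Sum>a\<in>A. real_of_int (k a) * (real_vec a \<bullet> u)) - real_of_int (\<Sum>a\<in>A. k a) * c"
    by (simp add: right_diff_distrib sum_subtractf sum_distrib_right)
  also have "\<dots> = (\<Sum>a\<in>A. \<Sum>j\<in>UNIV. real_of_int (k a * a $ j) * u $ j)"
    by (simp add: assms(1) inner_vec_def real_vec_def sum_distrib_left mult.assoc)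
  also have "\<dots> = (\<Sum>j\<in>UNIV. \<Sum>a\<in>A. real_of_int (k a * a $ j) * u $ j)"
    by (rule sum.swap)
  also have "\<dots> = (\<Sum>j\<in>UNIV. real_of_int (\<Sum>a\<in>A. k a * a $ j) * u $ j)"
    by (simp add: sum_distrib_right)
  also have "\<dots> = u $ i"
    by (simp add: assms(2) if_distrib[of "\<lambda>c. real_of_int c * _"] cong: if_cong)
  finally show ?thesis .
qed

text \<open>The inverse is explicit in the logarithms of \<open>precise y a\<close>, which is
  continuous, and positive in the interior. Its continuity is what the differentiation rule for
  inverse maps asks for.\<close>

lemma barycenter_gibbs_right_inverse:
  obtains g where "continuous_on (interior (Delta A)) g"
    "\<And>y. y \<in> interior (Delta A) \<Longrightarrow> barycenter (gibbs (g y)) = y"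
    "\<And>y. y \<in> interior (Delta A) \<Longrightarrow> gibbs (g y) = precise y"
proof -
  obtain k :: "'d \<Rightarrow> int^'d \<Rightarrow> int" where k: "\<And>i. (\<Sum>a\<in>A. k i a) = 0"
    "\<And>i j. (\<Sum>a\<in>A. k i a * a $ j) = (if j = i then 1 else 0)"
    using primitive_unit_combinations by blast
  define g where "g y = (\<chi> i. \<Sum>a\<in>A. real_of_int (k i a) * (ln (precise y a) - ln (w a)))" for y
  have g: "g y = u" if u: "precise y = gibbs u" for y u
  proof -
    have "g y $ i = u $ i" for i
    proof -
      have "g y $ i = (\<Sum>a\<in>A. real_of_int (k i a) * (real_vec a \<bullet> u - ln (partition_fun u)))"
        by (simp add: g_def u ln_gibbs)
      also have "\<dots> = u $ i" by (rule unit_combination_inner[OF k])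
      finally show ?thesis .
    qed
    then show ?thesis by (simp add: vec_eq_iff)
  qed
  show ?thesis
  proof
    have "continuous_on (interior (Delta A)) (\<lambda>y. precise y a)" for a
      by (rule continuous_on_subset[OF continuous_precise_component interior_subset])
    then show "continuous_on (interior (Delta A)) g"
      unfolding g_def by (auto intro!: continuous_on_vec_lambda continuous_intros dest!: precise_pos)
    show "barycenter (gibbs (g y)) = y" "gibbs (g y) = precise y" if "y \<in> interior (Delta A)" for y
      using precise_interior[OF that] g by metis+
  qed
qed

text \<open>The derivative of \<^term>\<open>precise\<close> is a rational expression in \<^term>\<open>precise\<close> itself, by
  Cramer's rule; so each order of differentiability yields the next.\<close>

lemma precise_Ck: "a \<in> A \<Longrightarrow> Ck_on k (interior (Delta A)) (\<lambda>y. precise y a)"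
proof -
  let ?U = "interior (Delta A)"
  obtain g where g: "continuous_on ?U g"
    "\<And>y. y \<in> ?U \<Longrightarrow> barycenter (gibbs (g y)) = y"
    "\<And>y. y \<in> ?U \<Longrightarrow> gibbs (g y) = precise y"
    using barycenter_gibbs_right_inverse by blast
  define M where "M y = covariance y (precise y)" for y
  have det: "det (M y) \<noteq> 0" if "y \<in> ?U" for y
    unfolding M_def using det_covariance_nonzero precise_pos[OF that] by blast
  \<comment> \<open>Column \<open>i\<close> of the inverse of \<open>M y\<close> by Cramer's rule,
    with division written as multiplication by \<open>inverse\<close> to match the closure rules of
    \<open>Ck_on\<close>.\<close>
  define C :: "real^'d \<Rightarrow> 'd \<Rightarrow> real^'d" where
    "C y i = (\<chi> k. det (\<chi> r c. if c = k then axis i 1 $ r else M y $ r $ c) * inverse (det (M y)))"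
    for y i
  have C: "M y *v C y i = axis i 1" if "y \<in> ?U" for y i
    using cramer[OF det[OF that]] unfolding C_def by (simp add: divide_inverse)
  define d where "d a i y = precise y a * (\<Sum>k\<in>UNIV. (real_vec a $ k + -1 * y $ k) * C y i $ k)" for a i y
  have der: "((\<lambda>y. precise y a) has_derivative (\<lambda>h. \<Sum>i\<in>UNIV. d a i y * h $ i)) (at y)"
    if y: "y \<in> ?U" and a: "a \<in> A" for y a
  proof -
    define G where "G h = (\<Sum>i\<in>UNIV. h $ i *\<^sub>R C y i)" for h
    have linG: "bounded_linear G"
      unfolding G_def
      by (intro bounded_linear_sum bounded_linear_scaleR_left[THEN bounded_linear_compose]
          bounded_linear_vec_nth)
    have MG: "M y *v G h = h" for h
    proof -
      have "M y *v G h = (\<Sum>i\<in>UNIV. h $ i *s axis i 1)"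
        by (simp add: G_def C[OF y] linear_sum[OF matrix_vector_mul_linear] matrix_vector_mult_scaleR
            scalar_mult_eq_scaleR)
      then show ?thesis by (simp add: basis_expansion)
    qed
    have GM: "G (M y *v h) = h" for h
    proof -
      have "M y *v G (M y *v h) = M y *v h" by (rule MG)
      then show ?thesis
        using cramer[OF det[OF y], of "G (M y *v h)" "M y *v h"]
          cramer[OF det[OF y], of h "M y *v h"] by simp
    qed
    have "(g has_derivative G) (at y)"
    proof (rule has_derivative_inverse_basic)
      show "((\<lambda>u. barycenter (gibbs u)) has_derivative (\<lambda>h. M y *v h)) (at (g y))"
        using barycenter_gibbs_has_derivative[of "g y"]
        by (simp only: g(2)[OF y]) (simp only: g(3)[OF y] M_def)
      show "G \<circ> (\<lambda>h. M y *v h) = id" by (simp add: fun_eq_iff GM)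
      show "continuous (at y) g" using g(1) y by (simp add: continuous_on_eq_continuous_at)
    qed (use linG y g(2) in auto)
    from has_derivative_compose[OF this gibbs_has_derivative[OF a]]
    have "((\<lambda>z. gibbs (g z) a) has_derivative (\<lambda>h. gibbs (g y) a * ((real_vec a - y) \<bullet> G h))) (at y)"
      by (simp only: g(2)[OF y])
    then have "((\<lambda>z. precise z a) has_derivative (\<lambda>h. gibbs (g y) a * ((real_vec a - y) \<bullet> G h))) (at y)"
      by (rule has_derivative_transform_within_open[OF _ open_interior y]) (simp add: g(3))
    moreover have "gibbs (g y) a * ((real_vec a - y) \<bullet> G h) = (\<Sum>i\<in>UNIV. d a i y * h $ i)" for h
      unfolding G_def d_def g(3)[OF y] inner_sum_right sum_distrib_left
      by (intro sum.cong refl) (simp add: inner_vec_def sum_distrib_left sum_distrib_right mult_ac)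
    ultimately show ?thesis by simp
  qed
  \<comment> \<open>All \<open>a\<close> are treated at once, since the derivative of one component
    involves all others through \<open>M\<close>.\<close>
  have "\<forall>a\<in>A. Ck_on k ?U (\<lambda>y. precise y a)"
  proof (induction k)
    case 0
    then show ?case
      by (auto intro: continuous_on_subset[OF continuous_precise_component interior_subset])
  next
    case (Suc k)
    have M: "Ck_on k ?U (\<lambda>y. M y $ i $ j)" for i j
    proof -
      have "Ck_on k ?U (\<lambda>y. \<Sum>a\<in>A. precise y a * ((real_vec a $ i + -1 * y $ i) * (real_vec a $ j + -1 * y $ j)))"
        by (intro Ck_on_sum Ck_on_mult Ck_on_add Ck_on_const Ck_on_coord Suc.IH[rule_format])
      then show ?thesis by (simp add: M_def covariance_def)
    qed
    have "Ck_on k ?U (\<lambda>y. C y i $ j)" for i j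
    proof -
      have "Ck_on k ?U (\<lambda>y. (\<chi> r c. if c = j then axis i 1 $ r else M y $ r $ c) $ r $ c)" for r c
        using M by (cases "c = j") (simp_all add: Ck_on_const)
      then show ?thesis
        unfolding C_def by (simp add: Ck_on_mult Ck_on_inverse Ck_on_det M det)
    qed
    then have "Ck_on k ?U (d a i)" if "a \<in> A" for a i
      unfolding d_def
      by (intro Ck_on_mult Ck_on_sum Ck_on_add Ck_on_const Ck_on_coord Suc.IH[rule_format] that)
    then show ?case
      using der unfolding Ck_on.simps by (intro ballI exI[of _ "d _"]) blast
  qed
  then show "a \<in> A \<Longrightarrow> Ck_on k (interior (Delta A)) (\<lambda>y. precise y a)" by blast
qed

end

section \<open>Toric patches with linear precision\<close>

lemma proj_pt_scale:
  assumes "c \<noteq> 0"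
  shows "proj_pt (\<lambda>i. c * v i) = proj_pt v"
proof -
  have "\<exists>e. (\<lambda>i. d * v i) = (\<lambda>i. e * (c * v i)) \<and> e \<noteq> 0" if "d \<noteq> 0" for d
    using assms that by (intro exI[of _ "d / c"]) auto
  moreover have "\<exists>e. (\<lambda>i. d * (c * v i)) = (\<lambda>i. e * v i) \<and> e \<noteq> 0" if "d \<noteq> 0" for d
    using assms that by (intro exI[of _ "d * c"]) (auto simp: mult.assoc)
  ultimately show ?thesis
    unfolding proj_pt_def by auto
qed

lemma proj_pt_self: "v \<in> proj_pt v"
  unfolding proj_pt_def using zero_neq_one by (force intro!: exI[of _ 1])

lemma proj_pt_eqD:
  assumes "proj_pt v = proj_pt v'"
  obtains c where "c \<noteq> 0" "v = (\<lambda>i. c * v' i)"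
  using proj_pt_self[of v] unfolding assms unfolding proj_pt_def by blast

lemma topspace_RP_topology:
  fixes A :: "'i set"
  shows "topspace (RP_topology A) = proj_pt ` punctured A"
proof -
  have "{v \<in> punctured A. proj_pt v \<in> proj_pt ` punctured A} = (punctured A :: ('i \<Rightarrow> real) set)"
    by auto
  then have "openin (RP_topology A) (proj_pt ` punctured A)"
    by (simp add: openin_RP_topology)
  then show ?thesis
    by (meson openin_RP_topology openin_subset openin_topspace subset_antisym)
qed

lemma rational_on_cong:
  assumes "\<And>x. x \<in> S \<Longrightarrow> f x = g x"
  shows "rational_on S f \<longleftrightarrow> rational_on S g"
  using assms by (simp add: rational_on_def)

section \<open>The toric variety in projective space and uniqueness of linear precision\<close>

context weighted_exponents
begin

lemma gibbs_closure_punctured: "p \<in> gibbs_closure \<Longrightarrow> p \<in> punctured A"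
  using gibbs_closure_properties[of p] unfolding punctured_def by auto

lemma monom_real_exp: "monom_real a (\<chi> i. exp (u $ i)) = exp (real_vec a \<bullet> u)"
  unfolding monom_real_def inner_vec_def real_vec_def
  by (simp add: exp_sum powr_real_of_int' [symmetric] exp_powr_real mult.commute)

lemma torus_image:
  "(\<lambda>x. proj_pt (on_index A (\<lambda>a. w a * monom_real a x))) ` {x. \<forall>i. 0 < x $ i}
     = proj_pt ` range gibbs"
proof -
  have "{x::real^'d. \<forall>i. 0 < x $ i} = range (\<lambda>u. \<chi> i. exp (u $ i))"
  proof (intro equalityI subsetI)
    fix x :: "real^'d" assume "x \<in> {x. \<forall>i. 0 < x $ i}"
    then have "x = (\<chi> i. exp ((\<chi> i. ln (x $ i)) $ i))" by (simp add: vec_eq_iff)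
    then show "x \<in> range (\<lambda>u. \<chi> i. exp (u $ i))" by blast
  qed auto
  moreover have "proj_pt (on_index A (\<lambda>a. w a * monom_real a (\<chi> i. exp (u $ i)))) = proj_pt (gibbs u)" for u
  proof -
    have "gibbs u = (\<lambda>a. inverse (partition_fun u) *
        on_index A (\<lambda>a. w a * monom_real a (\<chi> i. exp (u $ i))) a)"
      by (auto simp: gibbs_def on_index_def monom_real_exp divide_inverse)
    then show ?thesis
      using partition_fun_pos[of u] by (metis inverse_nonzero_iff_nonzero less_irrefl proj_pt_scale)
  qed
  ultimately show ?thesis by (simp add: image_image)
qed

text \<open>Gibbs measures are representatives of coordinate sum 1. Open sets of the quotient pull
  back to open sets of vectors, which gives one inclusion; for the other, membership in the cone
  over \<open>gibbs_closure\<close> is tested after a continuous normalization, so its complement is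
  open.\<close>

lemma X_toric_eq: "X_toric A w = proj_pt ` gibbs_closure"
proof
  show "proj_pt ` gibbs_closure \<subseteq> X_toric A w"
  proof clarify
    fix p assume p: "p \<in> gibbs_closure"
    have "\<exists>y\<in>proj_pt ` range gibbs. y \<in> T"
      if pT: "proj_pt p \<in> T" and T: "openin (RP_topology A) T" for T
    proof -
      obtain O' where O': "open O'" "{v \<in> punctured A. proj_pt v \<in> T} = punctured A \<inter> O'"
        using T unfolding openin_RP_topology openin_open by blast
      have "p \<in> O'"
        using O'(2) pT gibbs_closure_punctured[OF p] by blast
      then have "O' \<inter> range gibbs \<noteq> {}"
        using O'(1) p open_Int_closure_eq_empty[of O' "range gibbs"]
        unfolding gibbs_closure_def by blast
      then obtain u where "gibbs u \<in> O'" by blast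
      then have "proj_pt (gibbs u) \<in> T"
        using O'(2) gibbs_closure_punctured[OF gibbs_in_closure] by blast
      then show ?thesis by blast
    qed
    then show "proj_pt p \<in> X_toric A w"
      unfolding X_toric_def torus_image in_closure_of topspace_RP_topology
      using gibbs_closure_punctured[OF p] by blast
  qed
  \<comment> \<open>The sum of absolute values, because the plain coordinate sum can vanish on
    \<open>punctured A\<close>.\<close>
  define N where "N v = (\<Sum>a\<in>A. \<bar>v a\<bar>)" for v :: "int^'d \<Rightarrow> real"
  have N: "N v \<noteq> 0" if v: "v \<in> punctured A" for v
  proof
    assume "N v = 0"
    then have "\<forall>a\<in>A. v a = 0"
      unfolding N_def using finite_A by (simp add: sum_nonneg_eq_0_iff)
    then show False using v by (auto simp: punctured_def)
  qed
  \<comment> \<open>The sign \<open>e\<close> is needed because a negative multiple of a Gibbs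
    measure represents the same point.\<close>
  define s where "s e v = (\<lambda>a. e * inverse (N v) * v a)" for e :: real and v :: "int^'d \<Rightarrow> real"
  have cont: "continuous_on (punctured A) (s e)" for e
    unfolding s_def N_def using N[unfolded N_def]
    by (intro continuous_on_coordinatewise_then_product continuous_intros
        continuous_on_subset[OF continuous_on_product_coordinates]) auto
  have proj: "proj_pt v \<in> proj_pt ` gibbs_closure \<longleftrightarrow> s 1 v \<in> gibbs_closure \<or> s (-1) v \<in> gibbs_closure"
    if v: "v \<in> punctured A" for v
  proof
    assume "proj_pt v \<in> proj_pt ` gibbs_closure"
    then obtain k where k: "k \<in> gibbs_closure" "proj_pt v = proj_pt k" by blast
    obtain c where c: "c \<noteq> 0" "v = (\<lambda>i. c * k i)" using proj_pt_eqD[OF k(2)] .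
    have "N v = \<bar>c\<bar> * (\<Sum>a\<in>A. k a)"
      using gibbs_closure_properties(1)[OF k(1)] by (simp add: N_def c(2) abs_mult sum_distrib_left)
    then have Nv: "N v = \<bar>c\<bar>" using gibbs_closure_properties(3)[OF k(1)] by simp
    have "s (if c > 0 then 1 else -1) v = k"
      unfolding s_def Nv using c(1) by (auto simp: fun_cong[OF c(2)] fun_eq_iff)
    then show "s 1 v \<in> gibbs_closure \<or> s (-1) v \<in> gibbs_closure"
      using k(1) by (metis (full_types))
  next
    have "proj_pt (s e v) = proj_pt v" if "e \<noteq> 0" for e
      unfolding s_def using N[OF v] that by (intro proj_pt_scale) simp
    then have "proj_pt (s 1 v) = proj_pt v" "proj_pt (s (-1) v) = proj_pt v" by simp_all
    then show "s 1 v \<in> gibbs_closure \<or> s (-1) v \<in> gibbs_closure \<Longrightarrow>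
        proj_pt v \<in> proj_pt ` gibbs_closure"
      by (metis imageI)
  qed
  have op: "openin (top_of_set (punctured A)) (punctured A \<inter> s e -` (- gibbs_closure))" for e
    by (intro continuous_openin_preimage_gen cont open_Compl) (simp add: gibbs_closure_def)
  have "{v \<in> punctured A. proj_pt v \<in> proj_pt ` punctured A - proj_pt ` gibbs_closure}
      = (punctured A \<inter> s 1 -` (- gibbs_closure)) \<inter> (punctured A \<inter> s (-1) -` (- gibbs_closure))"
    using proj by auto
  then have "openin (RP_topology A) (proj_pt ` punctured A - proj_pt ` gibbs_closure)"
    unfolding openin_RP_topology using openin_Int[OF op op] by simp
  then have "closedin (RP_topology A) (proj_pt ` gibbs_closure)"
    unfolding closedin_def topspace_RP_topology using gibbs_closure_punctured by blast
  then show "X_toric A w \<subseteq> proj_pt ` gibbs_closure"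
    unfolding X_toric_def torus_image
    by (intro closure_of_minimal) (auto simp: gibbs_in_closure)
qed

lemma toric_normalized:
  assumes "toric_patch A w \<beta>" "y \<in> Delta A"
  shows "on_index A (\<lambda>a. normalized A \<beta> a y) \<in> gibbs_closure"
proof -
  have "proj_pt (on_index A (\<lambda>a. \<beta> a y)) \<in> proj_pt ` gibbs_closure"
    using assms unfolding toric_patch_def X_toric_eq by blast
  then obtain k where k: "k \<in> gibbs_closure" "proj_pt (on_index A (\<lambda>a. \<beta> a y)) = proj_pt k"
    by blast
  obtain c where c: "c \<noteq> 0" "on_index A (\<lambda>a. \<beta> a y) = (\<lambda>i. c * k i)"
    using proj_pt_eqD[OF k(2)] .
  have ck: "\<beta> a y = c * k a" if "a \<in> A" for a
    using fun_cong[OF c(2), of a] that by (simp add: on_index_def)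
  then have "(\<Sum>a\<in>A. \<beta> a y) = c * (\<Sum>a\<in>A. k a)"
    by (simp add: sum_distrib_left)
  then have "(\<Sum>a\<in>A. \<beta> a y) = c" using gibbs_closure_properties(3)[OF k(1)] by simp
  then have "on_index A (\<lambda>a. normalized A \<beta> a y) = k"
    using c(1) ck gibbs_closure_properties(2)[OF k(1)]
    by (auto simp: fun_eq_iff on_index_def normalized_def)
  then show ?thesis using k(1) by simp
qed

lemma normalized_reparametrize:
  "normalized A (reparametrize \<beta> \<psi>) a y = normalized A \<beta> a (\<psi> y)"
  by (simp add: normalized_def reparametrize_def)

lemma sum_normalized:
  assumes "patch A \<beta>" "y \<in> Delta A"
  shows "(\<Sum>a\<in>A. normalized A \<beta> a y) = 1"
proof -
  obtain a where a: "a \<in> A" "\<beta> a y \<noteq> 0" using assms unfolding patch_def by blast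
  have "0 \<le> \<beta> b y" if "b \<in> A" for b using assms that unfolding patch_def by blast
  then have "(\<Sum>b\<in>A. \<beta> b y) \<noteq> 0"
    using a finite_A by (auto simp: sum_nonneg_eq_0_iff)
  then show ?thesis
    by (simp add: normalized_def sum_divide_distrib[symmetric])
qed

text \<open>Linear precision for the coordinate functions says that the normalized values have
  barycenter \<open>y\<close>; they lie in \<open>gibbs_closure\<close>, where the barycenter is
  injective.\<close>

lemma linear_precision_unique:
  assumes \<beta>: "toric_patch A w \<beta>" and \<psi>: "\<psi> ` Delta A \<subseteq> Delta A"
    and lp: "linear_precision A (reparametrize \<beta> \<psi>)" and y: "y \<in> Delta A" and a: "a \<in> A"
  shows "normalized A (reparametrize \<beta> \<psi>) a y = precise y a"
proof -
  let ?q = "on_index A (\<lambda>a. normalized A \<beta> a (\<psi> y))"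
  have q: "?q \<in> gibbs_closure" using toric_normalized[OF \<beta>] \<psi> y by blast
  have "barycenter ?q $ i = y $ i" for i
  proof -
    have "linear (\<lambda>x::real^'d. x $ i)" by (simp add: bounded_linear.linear bounded_linear_vec_nth)
    then have "y $ i + 0 = (\<Sum>a\<in>A. normalized A (reparametrize \<beta> \<psi>) a y * (real_vec a $ i + 0))"
      using lp y unfolding linear_precision_def by blast
    then show ?thesis
      by (simp add: barycenter_def on_index_def normalized_reparametrize)
  qed
  then have "barycenter ?q = y" by (simp add: vec_eq_iff)
  then have "precise y = ?q" using precise_barycenter[OF q] by simp
  then show ?thesis using a by (simp add: on_index_def normalized_reparametrize)
qed

lemma linear_precision_reparametrization:
  assumes \<sigma>: "homeomorphism (Delta A) (Delta A) (tautological_map A \<beta>) \<sigma>" and \<beta>: "patch A \<beta>"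
  shows "linear_precision A (reparametrize \<beta> \<sigma>)"
  unfolding linear_precision_def normalized_reparametrize
proof (intro allI impI ballI)
  fix L :: "real^'d \<Rightarrow> real" and c y assume L: "linear L" and y: "y \<in> Delta A"
  have \<sigma>y: "\<sigma> y \<in> Delta A" using \<sigma> y unfolding homeomorphism_def by blast
  have "y = tautological_map A \<beta> (\<sigma> y)" using homeomorphism_apply2[OF \<sigma> y] by simp
  then have "L y = L (tautological_map A \<beta> (\<sigma> y))" by (rule arg_cong)
  also have "\<dots> = (\<Sum>a\<in>A. normalized A \<beta> a (\<sigma> y) * L (real_vec a))"
    by (simp add: tautological_map_def linear_sum[OF L] linear_cmul[OF L])
  finally show "L y + c = (\<Sum>a\<in>A. normalized A \<beta> a (\<sigma> y) * (L (real_vec a) + c))"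
    using sum_normalized[OF \<beta> \<sigma>y]
    by (simp add: distrib_left sum.distrib sum_distrib_right[symmetric])
qed

lemma rational_linear_precision_iff:
  assumes \<beta>: "toric_patch A w \<beta>" and proper: "proper_patch A \<beta>"
  shows "rational_linear_precision A \<beta> \<longleftrightarrow> (\<forall>a\<in>A. rational_on (Delta A) (\<lambda>y. precise y a))"
proof
  assume "rational_linear_precision A \<beta>"
  then obtain \<psi> \<psi>' where \<psi>: "homeomorphism (Delta A) (Delta A) \<psi> \<psi>'"
    "linear_precision A (reparametrize \<beta> \<psi>)"
    "\<forall>a\<in>A. rational_on (Delta A) (normalized A (reparametrize \<beta> \<psi>) a)"
    unfolding rational_linear_precision_def by blast
  have "\<psi> ` Delta A \<subseteq> Delta A" using homeomorphism_image1[OF \<psi>(1)] by simp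
  then show "\<forall>a\<in>A. rational_on (Delta A) (\<lambda>y. precise y a)"
    using \<psi>(3) linear_precision_unique[OF \<beta> _ \<psi>(2)] by (simp cong: rational_on_cong)
next
  assume rat: "\<forall>a\<in>A. rational_on (Delta A) (\<lambda>y. precise y a)"
  obtain \<sigma> where \<sigma>: "homeomorphism (Delta A) (Delta A) (tautological_map A \<beta>) \<sigma>"
    using proper unfolding proper_patch_def by blast
  have lp: "linear_precision A (reparametrize \<beta> \<sigma>)"
    using linear_precision_reparametrization[OF \<sigma>] \<beta> unfolding toric_patch_def by blast
  have sub: "\<sigma> ` Delta A \<subseteq> Delta A" using homeomorphism_image2[OF \<sigma>] by simp
  have "rational_on (Delta A) (normalized A (reparametrize \<beta> \<sigma>) a)" if "a \<in> A" for a
    using rat[rule_format, OF that] linear_precision_unique[OF \<beta> sub lp _ that]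
    by (simp cong: rational_on_cong)
  then show "rational_linear_precision A \<beta>"
    unfolding rational_linear_precision_def
    using proper lp homeomorphism_symD[OF \<sigma>] by blast
qed

lemma precise_toric: "toric_patch A w (\<lambda>a y. precise y a)"
  unfolding toric_patch_def patch_def X_toric_eq
proof (intro conjI ballI allI)
  fix y assume "y \<in> Delta A"
  then have "precise y \<in> gibbs_closure" by (rule precise_in)
  from gibbs_closure_properties[OF this] show "\<exists>a\<in>A. precise y a \<noteq> 0"
    by (metis sum.neutral zero_neq_one)
next
  have "on_index A (precise y) = precise y" if "y \<in> Delta A" for y
    using gibbs_closure_properties(2)[OF precise_in[OF that]] by (auto simp: on_index_def)
  then show "(\<lambda>y. proj_pt (on_index A (\<lambda>a. precise y a))) ` Delta A = proj_pt ` gibbs_closure"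
    by (simp add: precise_image[symmetric] image_image)
qed (use gibbs_closure_properties(1)[OF precise_in] continuous_precise_component precise_Ck in auto)

lemma precise_proper: "proper_patch A (\<lambda>a y. precise y a)"
proof -
  have "tautological_map A (\<lambda>a y. precise y a) y = y" if "y \<in> Delta A" for y
    using barycenter_precise[OF that] gibbs_closure_properties(3)[OF precise_in[OF that]]
    by (simp add: tautological_map_def normalized_def barycenter_def)
  then have "homeomorphism (Delta A) (Delta A) (tautological_map A (\<lambda>a y. precise y a)) (\<lambda>y. y)"
    unfolding homeomorphism_def by (simp cong: continuous_on_cong image_cong add: continuous_on_id)
  then show ?thesis
    using precise_toric unfolding proper_patch_def toric_patch_def by blast
qed

end

section \<open>Complex polynomial functions and rational maps\<close>

lemma complex_poly_fun_sum:
  "(\<And>i. i \<in> I \<Longrightarrow> complex_poly_fun (p i)) \<Longrightarrow> complex_poly_fun (\<lambda>x. \<Sum>i\<in>I. p i x)"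
  by (induction I rule: infinite_finite_induct) (auto intro: complex_poly_fun.intros)

lemma complex_poly_fun_prod:
  "(\<And>i. i \<in> I \<Longrightarrow> complex_poly_fun (p i)) \<Longrightarrow> complex_poly_fun (\<lambda>x. \<Prod>i\<in>I. p i x)"
  by (induction I rule: infinite_finite_induct) (auto intro: complex_poly_fun.intros)

lemma complex_poly_fun_power: "complex_poly_fun p \<Longrightarrow> complex_poly_fun (\<lambda>x. p x ^ n)"
  by (induction n) (auto intro: complex_poly_fun.intros)

lemma complex_poly_fun_diff:
  assumes "complex_poly_fun p" "complex_poly_fun q"
  shows "complex_poly_fun (\<lambda>x. p x - q x)"
proof -
  have "complex_poly_fun (\<lambda>x. p x + (- 1) * q x)"
    using assms by (intro complex_poly_fun.intros)
  then show ?thesis by simp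
qed

lemma complex_poly_fun_compose:
  "complex_poly_fun p \<Longrightarrow> (\<And>j. complex_poly_fun (\<lambda>x. g x j)) \<Longrightarrow> complex_poly_fun (\<lambda>x. p (g x))"
  by (induction rule: complex_poly_fun.induct) (auto intro: complex_poly_fun.intros)

lemma complex_poly_fun_on_line:
  "complex_poly_fun p \<Longrightarrow> \<exists>r. \<forall>s. p (\<lambda>i. x i + s * v i) = poly r s"
proof (induction rule: complex_poly_fun.induct)
  case (const c)
  show ?case by (intro exI[of _ "[:c:]"]) simp
next
  case (coord i)
  show ?case by (intro exI[of _ "[:x i, v i:]"]) simp
next
  case (add p q)
  then show ?case by (metis poly_add)
next
  case (mult p q)
  then show ?case by (metis poly_mult)
qed

text \<open>Zeros on a short segment in every real direction suffice, since a univariate polynomial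
  has finitely many roots. First all real points are reached along lines from \<open>x0\<close>,
  then complex ones.\<close>

lemma complex_poly_fun_eq_0:
  fixes x0 :: "'i \<Rightarrow> real"
  assumes p: "complex_poly_fun p"
    and ev: "\<And>v :: 'i \<Rightarrow> real. eventually (\<lambda>s. p (\<lambda>i. of_real (x0 i + s * v i)) = 0) (at_right 0)"
  shows "p z = 0"
proof -
  have real: "p (\<lambda>i. of_real (x i)) = 0" for x :: "'i \<Rightarrow> real"
  proof -
    define v where "v i = x i - x0 i" for i
    obtain r where r: "\<And>s. p (\<lambda>i. of_real (x0 i) + s * of_real (v i)) = poly r s"
      using complex_poly_fun_on_line[OF p] by metis
    obtain b where b: "b > 0" "\<And>s. 0 < s \<Longrightarrow> s < b \<Longrightarrow> p (\<lambda>i. of_real (x0 i + s * v i)) = 0"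
      using ev[of v] unfolding eventually_at_right_field by blast
    have "of_real ` {0<..<b} \<subseteq> {s. poly r s = 0}"
      using b(2) r[symmetric] by auto
    moreover have "infinite (of_real ` {0<..<b} :: complex set)"
      using b(1) by (auto dest!: finite_imageD simp: inj_on_def infinite_Ioo)
    ultimately have "r = 0" using poly_roots_finite finite_subset by blast
    then show ?thesis using r[of 1] by (simp add: v_def)
  qed
  \<comment> \<open>On the line through the real part of \<open>z\<close> in the direction of its
    imaginary part, real parameters give zeros, and \<open>z\<close> itself has parameter
    \<i>.\<close>
  obtain r where r: "\<And>s. p (\<lambda>i. of_real (Re (z i)) + s * of_real (Im (z i))) = poly r s"
    using complex_poly_fun_on_line[OF p] by metis
  have "range of_real \<subseteq> {s. poly r s = 0}"
  proof clarify
    fix s :: real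
    show "poly r (of_real s) = 0"
      using real[of "\<lambda>i. Re (z i) + s * Im (z i)"] r[of "of_real s"] by simp
  qed
  moreover have "infinite (range of_real :: complex set)"
    using finite_imageD[of of_real "UNIV :: real set"] by (auto simp: inj_on_def infinite_UNIV_char_0)
  ultimately have "r = 0" using poly_roots_finite finite_subset by blast
  then show ?thesis
    using r[of \<i>] complex_eq[of "z _"] by simp
qed

text \<open>On the line through \<open>x\<close> and \<open>y\<close> both factors restrict to
  nonzero univariate polynomials.\<close>

lemma complex_poly_fun_mult_nonzero:
  assumes p: "complex_poly_fun p" "p x \<noteq> 0" and q: "complex_poly_fun q" "q y \<noteq> 0"
  shows "\<exists>z. p z * q z \<noteq> 0"
proof -
  obtain r where r: "\<And>s. p (\<lambda>i. x i + s * (y i - x i)) = poly r s"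
    using complex_poly_fun_on_line[OF p(1)] by metis
  obtain t where t: "\<And>s. q (\<lambda>i. x i + s * (y i - x i)) = poly t s"
    using complex_poly_fun_on_line[OF q(1)] by metis
  have "r \<noteq> 0" "t \<noteq> 0" using r[of 0] p(2) t[of 1] q(2) by auto
  then have "r * t \<noteq> 0" by simp
  then obtain s where "poly (r * t) s \<noteq> 0"
    using poly_all_0_iff_0 by blast
  then show ?thesis by (metis poly_mult r t)
qed

lemma complex_poly_fun_prod_nonzero:
  assumes "finite I" "\<And>i. i \<in> I \<Longrightarrow> complex_poly_fun (p i)" "\<And>i. i \<in> I \<Longrightarrow> \<exists>x. p i x \<noteq> 0"
  shows "\<exists>z. (\<Prod>i\<in>I. p i z) \<noteq> 0"
  using assms
proof (induction I rule: finite_induct)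
  case (insert j I)
  obtain x where "p j x \<noteq> 0" using insert.prems(2) by blast
  moreover obtain y where "(\<Prod>i\<in>I. p i y) \<noteq> 0" using insert by auto
  moreover have "complex_poly_fun (\<lambda>x. \<Prod>i\<in>I. p i x)"
    using insert.prems(1) by (intro complex_poly_fun_prod) auto
  ultimately have "\<exists>z. p j z * (\<Prod>i\<in>I. p i z) \<noteq> 0"
    using insert.prems(1) by (intro complex_poly_fun_mult_nonzero) auto
  then show ?case using insert.hyps by simp
qed auto

section \<open>Homogeneous polynomials and the partial maps they induce\<close>

lemma homogeneous_polyD:
  assumes "homogeneous_poly m p"
  shows "complex_poly_fun p" "p (\<lambda>i. c * x i) = c ^ m * p x"
  using assms by (simp_all add: homogeneous_poly_def)

lemma homogeneous_poly_const: "homogeneous_poly 0 (\<lambda>x. c)"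
  by (simp add: homogeneous_poly_def complex_poly_fun.const)

lemma homogeneous_poly_coord: "homogeneous_poly 1 (\<lambda>x. x i)"
  by (simp add: homogeneous_poly_def complex_poly_fun.coord)

lemma homogeneous_poly_mult:
  "homogeneous_poly m p \<Longrightarrow> homogeneous_poly n q \<Longrightarrow> homogeneous_poly (m + n) (\<lambda>x. p x * q x)"
  by (auto simp: homogeneous_poly_def power_add intro: complex_poly_fun.mult)

lemma homogeneous_poly_cmult:
  "homogeneous_poly m p \<Longrightarrow> homogeneous_poly m (\<lambda>x. c * p x)"
  using homogeneous_poly_mult[OF homogeneous_poly_const, of m p c] by simp

lemma homogeneous_poly_diff:
  "homogeneous_poly m p \<Longrightarrow> homogeneous_poly m q \<Longrightarrow> homogeneous_poly m (\<lambda>x. p x - q x)"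
  by (auto simp: homogeneous_poly_def algebra_simps intro: complex_poly_fun_diff)

lemma homogeneous_poly_add:
  "homogeneous_poly m p \<Longrightarrow> homogeneous_poly m q \<Longrightarrow> homogeneous_poly m (\<lambda>x. p x + q x)"
  by (auto simp: homogeneous_poly_def algebra_simps intro: complex_poly_fun.add)

lemma homogeneous_poly_sum:
  "(\<And>i. i \<in> I \<Longrightarrow> homogeneous_poly m (p i)) \<Longrightarrow> homogeneous_poly m (\<lambda>x. \<Sum>i\<in>I. p i x)"
  by (auto simp: homogeneous_poly_def sum_distrib_left intro: complex_poly_fun_sum)

lemma homogeneous_poly_prod:
  "(\<And>i. i \<in> I \<Longrightarrow> homogeneous_poly (m i) (p i)) \<Longrightarrow>
    homogeneous_poly (\<Sum>i\<in>I. m i) (\<lambda>x. \<Prod>i\<in>I. p i x)"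
  by (auto simp: homogeneous_poly_def prod.distrib power_sum intro: complex_poly_fun_prod)

lemma homogeneous_poly_power:
  "homogeneous_poly m p \<Longrightarrow> homogeneous_poly (m * n) (\<lambda>x. p x ^ n)"
  by (auto simp: homogeneous_poly_def power_mult_distrib power_mult intro: complex_poly_fun_power)

lemma homogeneous_poly_compose:
  assumes p: "homogeneous_poly m p" and g: "\<And>j. homogeneous_poly k (\<lambda>x. g x j)"
  shows "homogeneous_poly (k * m) (\<lambda>x. p (g x))"
  unfolding homogeneous_poly_def
proof (intro conjI allI)
  show "complex_poly_fun (\<lambda>x. p (g x))"
    using homogeneous_polyD(1)[OF p] homogeneous_polyD(1)[OF g] by (rule complex_poly_fun_compose)
  fix c x
  have "g (\<lambda>i. c * x i) = (\<lambda>j. c ^ k * g x j)"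
    using homogeneous_polyD(2)[OF g] by (simp add: fun_eq_iff)
  then show "p (g (\<lambda>i. c * x i)) = c ^ (k * m) * p (g x)"
    by (simp add: homogeneous_polyD(2)[OF p] power_mult)
qed

lemma induced_map_Some_iff:
  assumes q: "homogeneous_poly k q" and P: "\<And>j. homogeneous_poly m (\<lambda>x. P x j)"
  shows "induced_map {x. q x \<noteq> 0} P p = Some r \<longleftrightarrow>
    (\<exists>x. x \<noteq> (\<lambda>_. 0) \<and> q x \<noteq> 0 \<and> P x \<noteq> (\<lambda>_. 0) \<and> p = proj_pt x \<and> r = proj_pt (P x))"
proof -
  have some: "proj_pt (P (SOME y. y \<in> proj_pt x)) = proj_pt (P x)" for x
  proof -
    have "(SOME y. y \<in> proj_pt x) \<in> proj_pt x" by (rule someI[of "\<lambda>y. y \<in> proj_pt x", OF proj_pt_self])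
    then obtain c where c: "c \<noteq> 0" "(SOME y. y \<in> proj_pt x) = (\<lambda>i. c * x i)"
      unfolding proj_pt_def by blast
    have "P (SOME y. y \<in> proj_pt x) = (\<lambda>j. c ^ m * P x j)"
      unfolding c(2) by (rule ext) (rule homogeneous_polyD(2)[OF P])
    then show ?thesis using c(1) by (simp add: proj_pt_scale)
  qed
  show ?thesis
    unfolding induced_map_def by (auto simp: some)
qed

text \<open>Any representative of the intermediate point is a multiple of \<open>P x\<close>, and
  homogeneity of \<open>q'\<close> and \<open>P'\<close> absorbs the factor. The domain of a
  composite thus becomes a polynomial condition on \<open>x\<close>.\<close>

lemma induced_map_comp_Some_iff:
  assumes q: "homogeneous_poly k q" and P: "\<And>j. homogeneous_poly m (\<lambda>x. P x j)"
    and q': "homogeneous_poly k' q'" and P': "\<And>j. homogeneous_poly m' (\<lambda>x. P' x j)"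
  shows "(induced_map {x. q' x \<noteq> 0} P' \<circ>\<^sub>m induced_map {x. q x \<noteq> 0} P) p = Some r \<longleftrightarrow>
    (\<exists>x. x \<noteq> (\<lambda>_. 0) \<and> q x \<noteq> 0 \<and> P x \<noteq> (\<lambda>_. 0) \<and> q' (P x) \<noteq> 0 \<and> P' (P x) \<noteq> (\<lambda>_. 0) \<and>
      p = proj_pt x \<and> r = proj_pt (P' (P x)))" (is "?L = ?R")
proof
  assume ?L
  then obtain x y where x: "x \<noteq> (\<lambda>_. 0)" "q x \<noteq> 0" "P x \<noteq> (\<lambda>_. 0)" "p = proj_pt x"
    and y: "q' y \<noteq> 0" "P' y \<noteq> (\<lambda>_. 0)" "proj_pt (P x) = proj_pt y" "r = proj_pt (P' y)"
    unfolding map_comp_Some_iff induced_map_Some_iff[OF q P] induced_map_Some_iff[OF q' P'] by blast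
  obtain c where c: "c \<noteq> 0" "y = (\<lambda>i. c * P x i)" using proj_pt_eqD[OF y(3)[symmetric]] .
  have P'y: "P' y = (\<lambda>j. c ^ m' * P' (P x) j)"
    unfolding c(2) using homogeneous_polyD(2)[OF P', of c "P x"] by (simp add: fun_eq_iff)
  have "q' (P x) \<noteq> 0"
    using y(1) unfolding c(2) homogeneous_polyD(2)[OF q'] by auto
  moreover have "P' (P x) \<noteq> (\<lambda>_. 0)" using y(2) P'y by auto
  moreover have "r = proj_pt (P' (P x))"
    unfolding y(4) P'y using c(1) by (simp add: proj_pt_scale)
  ultimately show ?R using x by blast
next
  assume ?R
  then show ?L
    unfolding map_comp_Some_iff induced_map_Some_iff[OF q P] induced_map_Some_iff[OF q' P'] by blast
qed

text \<open>The factor may vary with \<open>x\<close>; this is what permits clearing negative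
  exponents.\<close>

lemma induced_map_cong:
  assumes scale: "\<And>c x. c \<noteq> 0 \<Longrightarrow> x \<in> U \<Longrightarrow> (\<lambda>i. c * x i) \<in> U"
    and proportional: "\<And>x. x \<in> U \<Longrightarrow> \<exists>c. c \<noteq> 0 \<and> \<Phi> x = (\<lambda>i. c * \<Psi> x i)"
  shows "induced_map U \<Phi> = induced_map U \<Psi>"
proof
  fix p
  have zero_iff: "\<Phi> x \<noteq> (\<lambda>_. 0) \<longleftrightarrow> \<Psi> x \<noteq> (\<lambda>_. 0)" if "x \<in> U" for x
    using proportional[OF that] by (auto simp: fun_eq_iff)
  then have "{x \<in> U. x \<noteq> (\<lambda>_. 0) \<and> \<Phi> x \<noteq> (\<lambda>_. 0)} = {x \<in> U. x \<noteq> (\<lambda>_. 0) \<and> \<Psi> x \<noteq> (\<lambda>_. 0)}"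
    by blast
  moreover have "proj_pt (\<Phi> (SOME y. y \<in> proj_pt x)) = proj_pt (\<Psi> (SOME y. y \<in> proj_pt x))"
    if "x \<in> U" for x
  proof -
    have "(SOME y. y \<in> proj_pt x) \<in> proj_pt x" by (rule someI[of "\<lambda>y. y \<in> proj_pt x", OF proj_pt_self])
    then have "(SOME y. y \<in> proj_pt x) \<in> U"
      using scale[OF _ that] unfolding proj_pt_def by auto
    then show ?thesis using proportional proj_pt_scale by metis
  qed
  ultimately show "induced_map U \<Phi> p = induced_map U \<Psi> p"
    unfolding induced_map_def by (auto simp: image_iff)
qed

section \<open>The toric derivative in homogeneous coordinates\<close>

lemma sum_UNIV_option: "(\<Sum>j\<in>UNIV. f j) = f None + (\<Sum>i\<in>(UNIV::'i::finite set). f (Some i))"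
  by (simp add: UNIV_option_conv sum.reindex)

lemma prod_UNIV_option:
  fixes f :: "'i::finite option \<Rightarrow> 'b::comm_monoid_mult"
  shows "(\<Prod>j\<in>UNIV. f j) = f None * (\<Prod>i\<in>UNIV. f (Some i))"
  by (simp add: UNIV_option_conv prod.reindex)

locale weighted_exponents_deg = weighted_exponents A w
  for A :: "(int^'d) set" and w +
  assumes max_deg_nonzero: "max_deg A \<noteq> 0"
begin

definition hexp :: "int^'d \<Rightarrow> 'd option \<Rightarrow> int" where
  "hexp a j = (case j of None \<Rightarrow> max_deg A - total_deg a | Some i \<Rightarrow> a $ i)"

lemma hexp_simps [simp]: "hexp a None = max_deg A - total_deg a" "hexp a (Some i) = a $ i"
  by (simp_all add: hexp_def)

lemma sum_hexp: "(\<Sum>j\<in>UNIV. hexp a j) = max_deg A"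
  by (simp add: sum_UNIV_option total_deg_def)

text \<open>A crude bound for the absolute values of all exponents that occur.\<close>

definition shift :: nat where
  "shift = (\<Sum>a\<in>A. \<Sum>j\<in>UNIV. nat \<bar>hexp a j\<bar>)"

lemma shift_nonneg:
  assumes "a \<in> A" shows "0 \<le> int shift + hexp a j"
proof -
  have "nat \<bar>hexp a j\<bar> \<le> (\<Sum>j\<in>UNIV. nat \<bar>hexp a j\<bar>)"
    by (rule member_le_sum) auto
  also have "\<dots> \<le> shift"
    unfolding shift_def using assms finite_A by (intro member_le_sum) auto
  finally show ?thesis by linarith
qed

definition shifted_monom :: "int^'d \<Rightarrow> ('d option \<Rightarrow> complex) \<Rightarrow> complex" where
  "shifted_monom a x = (\<Prod>k\<in>UNIV. x k ^ nat (int shift + hexp a k))"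

definition shifted_deg :: nat where
  "shifted_deg = nat (int (CARD('d option) * shift) + max_deg A)"

text \<open>The degree is the same for all exponents, as each variable contributes
  \<open>shift\<close> and the rest sums to \<open>max_deg A\<close>. It is a sum of nonnegative
  terms, so \<open>nat\<close> truncates nothing even if \<open>max_deg A\<close> is
  negative.\<close>

lemma homogeneous_shifted_monom:
  assumes "a \<in> A"
  shows "homogeneous_poly shifted_deg (shifted_monom a)"
proof -
  have "int (\<Sum>k\<in>UNIV. 1 * nat (int shift + hexp a k)) = (\<Sum>k\<in>UNIV. int shift + hexp a k)"
    using shift_nonneg[OF assms] by simp
  also have "\<dots> = int (CARD('d option) * shift) + max_deg A"
    by (simp only: sum.distrib sum_hexp sum_constant of_nat_mult)
  finally have "(\<Sum>k\<in>UNIV. 1 * nat (int shift + hexp a k)) = shifted_deg"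
    unfolding shifted_deg_def by linarith
  moreover have "homogeneous_poly (\<Sum>k\<in>UNIV. 1 * nat (int shift + hexp a k)) (shifted_monom a)"
    unfolding shifted_monom_def[abs_def]
    by (intro homogeneous_poly_prod homogeneous_poly_power homogeneous_poly_coord)
  ultimately show ?thesis by simp
qed

text \<open>The toric derivative of the homogenization, multiplied by \<open>(\<Prod>\<^sub>k x k) ^ shift\<close> to clear
  negative exponents.\<close>

definition DF :: "('d option \<Rightarrow> complex) \<Rightarrow> 'd option \<Rightarrow> complex" where
  "DF x j = (\<Sum>a\<in>A. of_real (w a) * of_int (hexp a j) * shifted_monom a x)"

lemma homogeneous_DF: "homogeneous_poly shifted_deg (\<lambda>x. DF x j)"
  unfolding DF_def
  by (intro homogeneous_poly_sum homogeneous_poly_cmult homogeneous_shifted_monom)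

lemma shifted_monom_torus:
  assumes "a \<in> A" "\<And>k. x k \<noteq> 0"
  shows "shifted_monom a x = (\<Prod>k\<in>UNIV. x k) ^ shift * (\<Prod>k\<in>UNIV. x k powi hexp a k)"
proof -
  have "x k ^ nat (int shift + hexp a k) = x k ^ shift * x k powi hexp a k" for k
  proof -
    have "x k ^ nat (int shift + hexp a k) = x k powi (int shift + hexp a k)"
      using shift_nonneg[OF assms(1), of k] by (simp add: power_int_def)
    then show ?thesis using assms(2)[of k] by (simp add: power_int_add)
  qed
  then show ?thesis
    by (simp add: shifted_monom_def prod.distrib prod_power_distrib)
qed

lemma DF_torus:
  assumes x: "\<And>k. x k \<noteq> 0"
  shows "DF x j = (\<Prod>k\<in>UNIV. x k) ^ shift * (x j * partial_deriv j (F_hom A w) x)"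
proof -
  let ?c = "\<lambda>a. of_real (w a) * (\<Prod>k\<in>UNIV - {j}. x k powi hexp a k)"
  have "F_hom A w (x(j := t)) = (\<Sum>a\<in>A. ?c a * t powi hexp a j)" for t
  proof -
    have "F_hom A w (x(j := t)) = (\<Sum>a\<in>A. of_real (w a) * (\<Prod>k\<in>UNIV. (x(j := t)) k powi hexp a k))"
      by (simp add: F_hom_def prod_UNIV_option mult.assoc del: fun_upd_apply)
    also have "\<dots> = (\<Sum>a\<in>A. ?c a * t powi hexp a j)"
      by (intro sum.cong refl) (simp add: prod.remove[of UNIV j])
    finally show ?thesis .
  qed
  moreover have "((\<lambda>t. \<Sum>a\<in>A. ?c a * t powi hexp a j) has_field_derivative
      (\<Sum>a\<in>A. ?c a * (of_int (hexp a j) * x j powi (hexp a j - 1)))) (at (x j))"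
    unfolding has_field_derivative_def
    by (auto intro!: derivative_eq_intros has_derivative_power_int' x
        simp: sum_distrib_right sum_distrib_left mult_ac fun_eq_iff)
  ultimately have "partial_deriv j (F_hom A w) x
      = (\<Sum>a\<in>A. ?c a * (of_int (hexp a j) * x j powi (hexp a j - 1)))"
    unfolding partial_deriv_def by (simp add: DERIV_imp_deriv)
  then have "x j * partial_deriv j (F_hom A w) x
      = (\<Sum>a\<in>A. ?c a * (of_int (hexp a j) * (x j * x j powi (hexp a j - 1))))"
    by (simp add: sum_distrib_left mult_ac)
  also have "\<dots> = (\<Sum>a\<in>A. of_real (w a) * of_int (hexp a j) * (\<Prod>k\<in>UNIV. x k powi hexp a k))"
  proof (intro sum.cong refl)
    fix a
    have "x j * x j powi (hexp a j - 1) = x j powi hexp a j"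
      using x[of j] by (simp add: power_int_diff)
    then show "?c a * (of_int (hexp a j) * (x j * x j powi (hexp a j - 1)))
        = of_real (w a) * of_int (hexp a j) * (\<Prod>k\<in>UNIV. x k powi hexp a k)"
      by (simp add: prod.remove[of UNIV j])
  qed
  finally show ?thesis
    by (simp add: DF_def shifted_monom_torus x sum_distrib_left mult_ac)
qed

text \<open>A product of coordinates in place of the torus condition gives the form that
  \<open>rational_map\<close> demands.\<close>

lemma D_torus_eq: "D_torus (F_hom A w) = induced_map {x. (\<Prod>k\<in>UNIV. x k) \<noteq> 0} DF"
proof -
  have torus: "{x::'d option \<Rightarrow> complex. (\<Prod>k\<in>UNIV. x k) \<noteq> 0} = {x. \<forall>k. x k \<noteq> 0}"
    by simp
  show ?thesis
    unfolding D_torus_def torus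
  proof (rule induced_map_cong)
    fix x :: "'d option \<Rightarrow> complex" assume "x \<in> {x. \<forall>k. x k \<noteq> 0}"
    then have x: "x k \<noteq> 0" for k by simp
    show "\<exists>c. c \<noteq> 0 \<and> (\<lambda>j. x j * partial_deriv j (F_hom A w) x) = (\<lambda>j. c * DF x j)"
      using x by (intro exI[of _ "inverse ((\<Prod>k\<in>UNIV. x k) ^ shift)"]) (simp add: DF_torus fun_eq_iff)
  qed simp
qed

text \<open>Homogeneous coordinates of the point \<open>t = exp u\<close> of the source, and of the point of the target
  at which the barycenter \<open>y\<close> is read off; see \<open>DF_expt\<close>.\<close>

definition expt :: "real^'d \<Rightarrow> 'd option \<Rightarrow> complex" where
  "expt u j = (case j of None \<Rightarrow> 1 | Some i \<Rightarrow> of_real (exp (u $ i)))"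

definition hat :: "real^'d \<Rightarrow> 'd option \<Rightarrow> complex" where
  "hat y j = (case j of None \<Rightarrow> of_real (of_int (max_deg A) - (\<Sum>i\<in>UNIV. y $ i)) | Some i \<Rightarrow> of_real (y $ i))"

lemma expt_simps [simp]: "expt u None = 1" "expt u (Some i) = of_real (exp (u $ i))"
  by (simp_all add: expt_def)

lemma hat_simps [simp]:
  "hat y None = of_real (of_int (max_deg A) - (\<Sum>i\<in>UNIV. y $ i))" "hat y (Some i) = of_real (y $ i)"
  by (simp_all add: hat_def)

lemma expt_nonzero [simp]: "expt u j \<noteq> 0"
  by (cases j) auto

text \<open>The points \<open>hat y\<close> lie in the hyperplane of coordinate sum
  \<open>max_deg A\<close>. As this number is nonzero, the hyperplane misses the origin and serves
  as an affine chart of the target.\<close>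

lemma sum_hat: "(\<Sum>j\<in>UNIV. hat y j) = of_int (max_deg A)"
  by (simp add: sum_UNIV_option)

lemma hat_nonzero: "hat y \<noteq> (\<lambda>_. 0)"
  using sum_hat[of y] max_deg_nonzero by auto

lemma expt_powi: "(\<Prod>k\<in>UNIV. expt u k powi hexp a k) = of_real (exp (real_vec a \<bullet> u))"
proof -
  have "(\<Prod>k\<in>UNIV. expt u k powi hexp a k) = of_real (monom_real a (\<chi> i. exp (u $ i)))"
    by (simp add: prod_UNIV_option monom_real_def)
  then show ?thesis by (simp add: monom_real_exp)
qed

text \<open>\<open>hat\<close> is affine and sends the exponent \<open>a\<close> to
  \<open>hexp a\<close>, so it commutes with weighted means of total weight 1.\<close>

lemma hat_barycenter:
  assumes "(\<Sum>a\<in>A. p a) = 1"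
  shows "hat (barycenter p) j = (\<Sum>a\<in>A. of_real (p a) * of_int (hexp a j))"
proof (cases j)
  case None
  have "(\<Sum>i\<in>UNIV. barycenter p $ i) = (\<Sum>a\<in>A. p a * of_int (total_deg a))"
    by (simp add: barycenter_def total_deg_def real_vec_def sum_distrib_left) (rule sum.swap)
  then have "of_int (max_deg A) - (\<Sum>i\<in>UNIV. barycenter p $ i)
      = (\<Sum>a\<in>A. p a) * of_int (max_deg A) - (\<Sum>a\<in>A. p a * of_int (total_deg a))"
    using assms by simp
  also have "\<dots> = (\<Sum>a\<in>A. p a * of_int (hexp a None))"
    by (simp add: sum_distrib_right sum_subtractf right_diff_distrib)
  finally show ?thesis
    by (simp only: None hat_simps) simp
next
  case (Some i)
  then show ?thesis by (simp add: barycenter_def real_vec_def)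
qed

lemma DF_expt:
  obtains c where "c \<noteq> 0" "DF (expt u) = (\<lambda>j. c * hat (barycenter (gibbs u)) j)"
proof
  let ?c = "(\<Prod>k\<in>UNIV. expt u k) ^ shift * of_real (partition_fun u)"
  show "?c \<noteq> 0" using partition_fun_pos[of u] by simp
  show "DF (expt u) = (\<lambda>j. ?c * hat (barycenter (gibbs u)) j)"
  proof
    fix j
    have "w a * exp (real_vec a \<bullet> u) = partition_fun u * gibbs u a" if "a \<in> A" for a
      using partition_fun_pos[of u] that by (simp add: gibbs_in)
    then have weight: "complex_of_real (w a) * of_real (exp (real_vec a \<bullet> u))
        = of_real (partition_fun u) * of_real (gibbs u a)" if "a \<in> A" for a
      using that by (metis of_real_mult)
    let ?\<pi> = "(\<Prod>k\<in>UNIV. expt u k) ^ shift"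
    have "DF (expt u) j = (\<Sum>a\<in>A. of_int (hexp a j) * (?\<pi> *
        (of_real (w a) * of_real (exp (real_vec a \<bullet> u)))))"
      by (simp add: DF_def shifted_monom_torus expt_powi mult_ac cong: sum.cong)
    also have "\<dots> = (\<Sum>a\<in>A. of_int (hexp a j) * (?\<pi> * (of_real (partition_fun u) * of_real (gibbs u a))))"
      by (intro sum.cong refl) (simp only: weight)
    also have "\<dots> = ?c * hat (barycenter (gibbs u)) j"
      by (simp add: hat_barycenter sum_gibbs sum_distrib_left mult_ac)
    finally show "DF (expt u) j = ?c * hat (barycenter (gibbs u)) j" .
  qed
qed

text \<open>Scaling the points \<open>expt u\<close> gives all positive real vectors, among them a
  real neighbourhood of (1,...,1).\<close>

lemma homogeneous_zero_expt:
  assumes g: "homogeneous_poly m g" and zero: "\<And>u. g (expt u) = 0"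
  shows "g x = 0"
proof -
  have positive: "g (\<lambda>j. of_real (r j)) = 0" if r: "\<And>j. r j > 0" for r
  proof -
    have "(\<lambda>j. complex_of_real (r j)) = (\<lambda>j. of_real (r None) * expt (\<chi> i. ln (r (Some i) / r None)) j)"
    proof
      fix j show "complex_of_real (r j) = of_real (r None) * expt (\<chi> i. ln (r (Some i) / r None)) j"
        using r[of None] r[of j] by (cases j) (auto simp: less_imp_neq[THEN not_sym])
    qed
    then show ?thesis using homogeneous_polyD(2)[OF g] zero by simp
  qed
  have near_1: "eventually (\<lambda>s. \<forall>j. 1 + s * v j > 0) (at_right 0)" for v :: "'d option \<Rightarrow> real"
  proof (rule eventually_all_finite)
    fix j
    have "((\<lambda>s. 1 + s * v j) \<longlongrightarrow> 1 + 0 * v j) (at_right 0)"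
      by (intro tendsto_intros)
    then show "eventually (\<lambda>s. 1 + s * v j > 0) (at_right 0)"
      by (rule order_tendstoD) simp
  qed
  show ?thesis
  proof (rule complex_poly_fun_eq_0[OF homogeneous_polyD(1)[OF g], of "\<lambda>_. 1"])
    fix v :: "'d option \<Rightarrow> real"
    show "eventually (\<lambda>s. g (\<lambda>j. of_real (1 + s * v j)) = 0) (at_right 0)"
      by (rule eventually_mono[OF near_1[of v]]) (simp only: positive)
  qed
qed

text \<open>The cone over the interior contains a real neighbourhood of \<open>hat y0\<close>: a
  perturbed point is rescaled to the hyperplane and read as \<open>hat\<close> of a point near
  \<open>y0\<close>.\<close>

lemma homogeneous_zero_hat:
  assumes g: "homogeneous_poly m g" and zero: "\<And>y. y \<in> interior (Delta A) \<Longrightarrow> g (hat y) = 0"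
  shows "g x = 0"
proof -
  let ?N = "real_of_int (max_deg A)"
  obtain y0 where y0: "y0 \<in> interior (Delta A)" using interior_Delta_nonempty by blast
  define x0 where "x0 j = Re (hat y0 j)" for j
  have "eventually (\<lambda>s. g (\<lambda>j. of_real (x0 j + s * v j)) = 0) (at_right 0)"
    for v :: "'d option \<Rightarrow> real"
  proof -
    \<comment> \<open>The coordinate sum of the perturbed point divided by
      \<open>?N\<close>.\<close>
    define c where "c s = 1 + s * ((\<Sum>j\<in>UNIV. v j) / ?N)" for s
    define y where "y s = (\<chi> i. (y0 $ i + s * v (Some i)) / c s)" for s
    have c: "(c \<longlongrightarrow> 1 + 0 * ((\<Sum>j\<in>UNIV. v j) / ?N)) (at_right 0)"
      unfolding c_def by (intro tendsto_intros)
    then have "(y \<longlongrightarrow> (\<chi> i. (y0 $ i + 0 * v (Some i)) / 1)) (at_right 0)"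
      unfolding y_def by (intro tendsto_intros) auto
    then have "(y \<longlongrightarrow> y0) (at_right 0)" by simp
    then have "eventually (\<lambda>s. y s \<in> interior (Delta A)) (at_right 0)"
      using y0 by (rule topological_tendstoD[OF _ open_interior])
    moreover have "eventually (\<lambda>s. c s > 0) (at_right 0)"
      using c by (rule order_tendstoD) simp
    ultimately show ?thesis
    proof eventually_elim
      case (elim s)
      have "complex_of_real (x0 j + s * v j) = of_real (c s) * hat (y s) j" for j
      proof (cases j)
        case None
        have "c s * (\<Sum>i\<in>UNIV. y s $ i) = (\<Sum>i\<in>UNIV. y0 $ i + s * v (Some i))"
          using elim(2) by (simp add: y_def sum_divide_distrib[symmetric])
        moreover have "c s * ?N = ?N + s * (v None + (\<Sum>i\<in>UNIV. v (Some i)))"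
          using max_deg_nonzero by (simp add: c_def field_simps sum_UNIV_option)
        ultimately have "x0 None + s * v None = c s * (?N - (\<Sum>i\<in>UNIV. y s $ i))"
          by (simp add: x0_def right_diff_distrib sum.distrib sum_distrib_left algebra_simps)
        then show ?thesis by (simp only: None hat_simps of_real_mult[symmetric])
      next
        case (Some i)
        then show ?thesis using elim(2) by (simp add: x0_def y_def flip: of_real_mult)
      qed
      then have "g (\<lambda>j. of_real (x0 j + s * v j)) = of_real (c s) ^ m * g (hat (y s))"
        using homogeneous_polyD(2)[OF g] by presburger
      then show ?case using zero[OF elim(1)] by simp
    qed
  qed
  then show ?thesis
    by (rule complex_poly_fun_eq_0[OF homogeneous_polyD(1)[OF g], of x0])
qed

text \<open>The linear form \<sigma> equals 1 on all \<open>hat y\<close>, so its powers raise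
  degrees without changing values. Every large degree is provided so that several polynomials can
  share one.\<close>

lemma homogenization:
  assumes "real_polynomial_function p"
  shows "\<exists>m0. \<forall>m\<ge>m0. \<exists>P. homogeneous_poly m P \<and> (\<forall>y. P (hat y) = of_real (p y))"
proof -
  define \<sigma> where "\<sigma> z = inverse (of_int (max_deg A)) * (\<Sum>j\<in>UNIV. z j)" for z :: "'d option \<Rightarrow> complex"
  have \<sigma>: "homogeneous_poly 1 \<sigma>"
    unfolding \<sigma>_def[abs_def]
    by (intro homogeneous_poly_cmult homogeneous_poly_sum homogeneous_poly_coord)
  have \<sigma>_hat [simp]: "\<sigma> (hat y) = 1" for y
    using max_deg_nonzero by (simp add: \<sigma>_def sum_hat)
  have \<sigma>_pow: "homogeneous_poly n (\<lambda>z. \<sigma> z ^ n)" for n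
    using homogeneous_poly_power[OF \<sigma>, of n] by simp
  show ?thesis
    using assms
  proof (induction p rule: real_polynomial_function.induct)
    case (linear f)
    have f: "f y = (\<Sum>i\<in>UNIV. f (axis i 1) * y $ i)" for y
    proof -
      have "f y = f (\<Sum>i\<in>UNIV. y $ i *\<^sub>R axis i 1)"
        using basis_expansion[of y] by (simp add: scalar_mult_eq_scaleR)
      also have "\<dots> = (\<Sum>i\<in>UNIV. f (axis i 1) * y $ i)"
        using linear by (simp add: linear_sum linear_cmul bounded_linear.linear mult.commute)
      finally show ?thesis .
    qed
    show ?case
    proof (intro exI[of _ 1] allI impI)
      fix m :: nat assume "m \<ge> 1"
      define P where "P z = \<sigma> z ^ (m - 1) * (\<Sum>i\<in>UNIV. of_real (f (axis i 1)) * z (Some i))" for z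
      have "homogeneous_poly (m - 1 + 1) P"
        unfolding P_def[abs_def]
        by (intro homogeneous_poly_mult \<sigma>_pow homogeneous_poly_sum homogeneous_poly_cmult homogeneous_poly_coord)
      moreover have "P (hat y) = of_real (f y)" for y
        by (subst f) (simp add: P_def)
      ultimately show "\<exists>P. homogeneous_poly m P \<and> (\<forall>y. P (hat y) = of_real (f y))"
        using \<open>m \<ge> 1\<close> by auto
    qed
  next
    case (const c)
    show ?case
    proof (intro exI[of _ 0] allI impI)
      fix m :: nat
      show "\<exists>P. homogeneous_poly m P \<and> (\<forall>y. P (hat y) = of_real c)"
        by (intro exI[of _ "\<lambda>z. of_real c * \<sigma> z ^ m"] conjI homogeneous_poly_cmult \<sigma>_pow) simp
    qed
  next
    case (add p q)
    then obtain m1 m2 where m1: "\<And>m. m \<ge> m1 \<Longrightarrow> \<exists>P. homogeneous_poly m P \<and> (\<forall>y. P (hat y) = of_real (p y))"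
      and m2: "\<And>m. m \<ge> m2 \<Longrightarrow> \<exists>P. homogeneous_poly m P \<and> (\<forall>y. P (hat y) = of_real (q y))" by blast
    show ?case
    proof (intro exI[of _ "max m1 m2"] allI impI)
      fix m assume "m \<ge> max m1 m2"
      then obtain P Q where "homogeneous_poly m P" "\<forall>y. P (hat y) = of_real (p y)"
        "homogeneous_poly m Q" "\<forall>y. Q (hat y) = of_real (q y)"
        using m1[of m] m2[of m] by auto
      then show "\<exists>P. homogeneous_poly m P \<and> (\<forall>y. P (hat y) = of_real (p y + q y))"
        by (intro exI[of _ "\<lambda>z. P z + Q z"]) (simp add: homogeneous_poly_add)
    qed
  next
    case (mult p q)
    then obtain m1 m2 where m1: "\<And>m. m \<ge> m1 \<Longrightarrow> \<exists>P. homogeneous_poly m P \<and> (\<forall>y. P (hat y) = of_real (p y))"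
      and m2: "\<And>m. m \<ge> m2 \<Longrightarrow> \<exists>P. homogeneous_poly m P \<and> (\<forall>y. P (hat y) = of_real (q y))" by blast
    show ?case
    proof (intro exI[of _ "m1 + m2"] allI impI)
      fix m assume m: "m \<ge> m1 + m2"
      then obtain P Q where PQ: "homogeneous_poly m1 P" "\<forall>y. P (hat y) = of_real (p y)"
        "homogeneous_poly (m - m1) Q" "\<forall>y. Q (hat y) = of_real (q y)"
        using m1[of m1] m2[of "m - m1"] m by (auto simp: le_diff_conv2)
      then show "\<exists>P. homogeneous_poly m P \<and> (\<forall>y. P (hat y) = of_real (p y * q y))"
        using homogeneous_poly_mult[OF PQ(1,3)] m
        by (intro exI[of _ "\<lambda>z. P z * Q z"]) simp
    qed
  qed
qed

end

section \<open>Rational blending functions and birational toric derivatives\<close>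

text \<open>The minors turn equality of projective points into polynomial equations, to which
  density arguments apply.\<close>

lemma proj_pt_eqI:
  assumes u: "u \<noteq> (\<lambda>_. 0)" and v: "v \<noteq> (\<lambda>_. 0)" and uv: "\<And>i j. u i * v j = u j * v i"
  shows "proj_pt u = proj_pt v"
proof -
  obtain j where j: "v j \<noteq> 0" using v by auto
  have eq: "u = (\<lambda>i. (u j / v j) * v i)"
    using uv[of _ j] j by (simp add: fun_eq_iff field_simps)
  then have "u j \<noteq> 0" using u by auto
  then have "proj_pt (\<lambda>i. (u j / v j) * v i) = proj_pt v"
    using j by (intro proj_pt_scale) simp
  then show ?thesis using eq by simp
qed

section \<open>From rational blending functions to an inverse of the toric derivative\<close>

context weighted_exponents_deg
begin

lemma homogeneous_torus: "homogeneous_poly CARD('d option) (\<lambda>x. \<Prod>k\<in>(UNIV::'d option set). x k)"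
  using homogeneous_poly_prod[of "UNIV :: 'd option set" "\<lambda>_. 1" "\<lambda>k x. x k", OF homogeneous_poly_coord]
  by simp

lemma rational_map_D_torus: "rational_map (D_torus (F_hom A w))"
proof -
  have "\<exists>r. D_torus (F_hom A w) (proj_pt (expt 0)) = Some r"
    unfolding D_torus_eq induced_map_Some_iff[OF homogeneous_torus homogeneous_DF]
  proof (intro exI conjI)
    show "expt 0 \<noteq> (\<lambda>_. 0)" by (auto simp: fun_eq_iff)
    obtain c where "c \<noteq> 0" "DF (expt 0) = (\<lambda>j. c * hat (barycenter (gibbs 0)) j)" by (rule DF_expt)
    then show "DF (expt 0) \<noteq> (\<lambda>_. 0)"
      using hat_nonzero by (auto simp: fun_eq_iff)
  qed auto
  then have "dom (D_torus (F_hom A w)) \<noteq> {}" by auto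
  then show ?thesis
    unfolding rational_map_def D_torus_eq using homogeneous_torus homogeneous_DF by blast
qed

lemma birational_if_rational:
  assumes rat: "\<And>a. a \<in> A \<Longrightarrow> rational_on (Delta A) (\<lambda>y. precise y a)"
  shows "birational_isomorphism (D_torus (F_hom A w))"
proof -
  have "\<forall>a\<in>A. \<exists>p q. real_polynomial_function p \<and> real_polynomial_function q \<and>
      (\<exists>x\<in>Delta A. q x \<noteq> 0) \<and> (\<forall>x\<in>Delta A. q x \<noteq> 0 \<longrightarrow> precise x a = p x / q x)"
    using rat unfolding rational_on_def by blast
  from bchoice[OF this] obtain p where "\<forall>a\<in>A. \<exists>q. real_polynomial_function (p a) \<and>
      real_polynomial_function q \<and> (\<exists>x\<in>Delta A. q x \<noteq> 0) \<and>
      (\<forall>x\<in>Delta A. q x \<noteq> 0 \<longrightarrow> precise x a = p a x / q x)" by blast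
  from bchoice[OF this] obtain q where q: "\<forall>a\<in>A. real_polynomial_function (p a) \<and>
      real_polynomial_function (q a) \<and> (\<exists>x\<in>Delta A. q a x \<noteq> 0) \<and>
      (\<forall>x\<in>Delta A. q a x \<noteq> 0 \<longrightarrow> precise x a = p a x / q a x)" by blast
  then have pq: "real_polynomial_function (p a)" "real_polynomial_function (q a)"
    "\<exists>x\<in>Delta A. q a x \<noteq> 0" if "a \<in> A" for a
    using that by simp_all
  have precise_eq: "precise x a = p a x / q a x" if "a \<in> A" "x \<in> Delta A" "q a x \<noteq> 0" for a x
    using q that by simp
  have "\<forall>a\<in>A. \<exists>m0. \<forall>m\<ge>m0. \<exists>P. homogeneous_poly m P \<and> (\<forall>y. P (hat y) = of_real (p a y))"
    using homogenization[OF pq(1)] by blast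
  from bchoice[OF this] obtain mp where mp: "\<forall>a\<in>A. \<forall>m\<ge>mp a.
      \<exists>P. homogeneous_poly m P \<and> (\<forall>y. P (hat y) = of_real (p a y))" by blast
  have "\<forall>a\<in>A. \<exists>m0. \<forall>m\<ge>m0. \<exists>P. homogeneous_poly m P \<and> (\<forall>y. P (hat y) = of_real (q a y))"
    using homogenization[OF pq(2)] by blast
  from bchoice[OF this] obtain mq where mq: "\<forall>a\<in>A. \<forall>m\<ge>mq a.
      \<exists>P. homogeneous_poly m P \<and> (\<forall>y. P (hat y) = of_real (q a y))" by blast
  define m where "m = (\<Sum>a\<in>A. mp a + mq a)"
  have m: "mp a \<le> m" "mq a \<le> m" if "a \<in> A" for a
    using member_le_sum[OF that, of "\<lambda>a. mp a + mq a"] finite_A unfolding m_def by auto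
  have "\<forall>a\<in>A. \<exists>P. homogeneous_poly m P \<and> (\<forall>y. P (hat y) = of_real (p a y))"
    using mp m(1) by blast
  from bchoice[OF this] obtain P where P: "homogeneous_poly m (P a)" "P a (hat y) = of_real (p a y)"
    if "a \<in> A" for a y by blast
  have "\<forall>a\<in>A. \<exists>P. homogeneous_poly m P \<and> (\<forall>y. P (hat y) = of_real (q a y))"
    using mq m(2) by blast
  from bchoice[OF this] obtain Q where Q: "homogeneous_poly m (Q a)" "Q a (hat y) = of_real (q a y)"
    if "a \<in> A" for a y by blast
  obtain l :: "'d \<Rightarrow> int^'d \<Rightarrow> int" where l: "\<And>i. (\<Sum>a\<in>A. l i a) = 0"
    "\<And>i j. (\<Sum>a\<in>A. l i a * a $ j) = (if j = i then 1 else 0)"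
    using primitive_unit_combinations by blast
  \<comment> \<open>The exponents for the homogenizing coordinate are 0, matching
    \<open>expt u None = 1\<close>.\<close>
  define k where "k j a = (case j of None \<Rightarrow> 0 | Some i \<Rightarrow> l i a)" for j a
  define M where "M = (\<Sum>a\<in>A. \<Sum>j\<in>UNIV. nat \<bar>k j a\<bar>)"
  have M: "0 \<le> int M + k j a" "0 \<le> int M - k j a" if "a \<in> A" for j a
  proof -
    have "nat \<bar>k j a\<bar> \<le> (\<Sum>j\<in>UNIV. nat \<bar>k j a\<bar>)"
      by (rule member_le_sum) auto
    also have "\<dots> \<le> M"
      unfolding M_def using that finite_A by (intro member_le_sum) auto
    finally show "0 \<le> int M + k j a" "0 \<le> int M - k j a" by linarith+
  qed
  \<comment> \<open>The Laurent monomial with exponents \<open>k j a\<close> in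
    \<open>P a z / (w a * Q a z)\<close>, times the product of all
    \<open>(P a z * w a * Q a z) ^ M\<close>. This factor clears denominators and does not depend on
    \<open>j\<close>, so the projective point is unchanged and all coordinates have one
    degree.\<close>
  define T where "T z j = (\<Prod>a\<in>A. P a z ^ nat (int M + k j a) * (of_real (w a) * Q a z) ^ nat (int M - k j a))"
    for z j
  define e where "e = card A * (m * (2 * M))"
  have T: "homogeneous_poly e (\<lambda>z. T z j)" for j
  proof -
    have "homogeneous_poly (\<Sum>a\<in>A. m * nat (int M + k j a) + m * nat (int M - k j a)) (\<lambda>z. T z j)"
      unfolding T_def
      by (intro homogeneous_poly_prod homogeneous_poly_mult homogeneous_poly_power homogeneous_poly_cmult P Q)
    moreover have "m * nat (int M + k j a) + m * nat (int M - k j a) = m * (2 * M)" if "a \<in> A" for a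
    proof -
      have "nat (int M + k j a) + nat (int M - k j a) = 2 * M" using M[OF that, of j] by linarith
      then show ?thesis by (metis distrib_left)
    qed
    ultimately show ?thesis by (simp add: e_def)
  qed
  define r where "r z = (\<Prod>a\<in>A. P a z * Q a z)" for z
  define n where "n = (\<Sum>a\<in>A. m + m)"
  have r: "homogeneous_poly n r"
    unfolding r_def[abs_def] n_def by (intro homogeneous_poly_prod homogeneous_poly_mult P Q)
  have r_factors: "P a z \<noteq> 0" "Q a z \<noteq> 0" if "r z \<noteq> 0" "a \<in> A" for a z
    using that finite_A unfolding r_def by auto
  have T_nonzero: "T z j \<noteq> 0" if "r z \<noteq> 0" for z j
    using r_factors[OF that] w_pos finite_A unfolding T_def by force
  have r_nonzero: "\<exists>z. r z \<noteq> 0"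
    unfolding r_def
  proof (rule complex_poly_fun_prod_nonzero[OF finite_A])
    fix a assume a: "a \<in> A"
    show "complex_poly_fun (\<lambda>z. P a z * Q a z)"
      using P(1)[OF a] Q(1)[OF a] by (intro complex_poly_fun.mult) (auto dest: homogeneous_polyD)
    obtain x where "q a x \<noteq> 0" using pq(3)[OF a] by blast
    then have "Q a (hat x) \<noteq> 0" by (simp add: Q(2)[OF a])
    \<comment> \<open>Moving to the interior matters: there \<open>precise\<close> is positive, so
      the numerator is nonzero as well.\<close>
    then obtain y where y: "y \<in> interior (Delta A)" "Q a (hat y) \<noteq> 0"
      using homogeneous_zero_hat[OF Q(1)[OF a]] by blast
    then have "q a y \<noteq> 0" "y \<in> Delta A" using interior_subset by (auto simp: Q(2)[OF a])
    then have "p a y \<noteq> 0"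
      using precise_eq[OF a, of y] precise_pos[OF y(1) a] by auto
    then show "\<exists>z. P a z * Q a z \<noteq> 0"
      using y(2) by (intro exI[of _ "hat y"]) (simp add: P(2)[OF a])
  qed
  have T_hat: "\<exists>c. c \<noteq> 0 \<and> T (hat (barycenter (gibbs u))) = (\<lambda>j. c * expt u j)"
    if nz: "r (hat (barycenter (gibbs u))) \<noteq> 0" for u
  proof -
    let ?y = "barycenter (gibbs u)"
    have y: "?y \<in> Delta A" "precise ?y = gibbs u"
      by (simp_all add: gibbs_closure_barycenter gibbs_in_closure precise_barycenter)
    define X where "X a = exp (real_vec a \<bullet> u - ln (partition_fun u))" for a
    define Y where "Y a = of_real (w a) * Q a (hat ?y)" for a
    have PX: "P a (hat ?y) = of_real (X a) * Y a" if a: "a \<in> A" for a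
    proof -
      have "q a ?y \<noteq> 0" using r_factors(2)[OF nz a] by (simp add: Q(2)[OF a])
      then have "p a ?y = gibbs u a * q a ?y" using precise_eq[OF a y(1)] y(2) by simp
      moreover have "gibbs u a = X a * w a"
        using partition_fun_pos[of u] a by (simp add: X_def gibbs_in exp_diff)
      ultimately show ?thesis by (simp add: P(2)[OF a] Q(2)[OF a] Y_def)
    qed
    have Y: "Y a \<noteq> 0" if "a \<in> A" for a
      using r_factors(2)[OF nz that] w_pos[OF that] by (simp add: Y_def)
    \<comment> \<open>As \<open>P a\<close> is \<open>X a * Y a\<close> here, each factor of
      \<open>T\<close> is \<open>X a ^ (M + k j a) * Y a ^ (2 * M)\<close>; \<open>c\<close>
      collects what does not depend on \<open>j\<close>.\<close>
    define c where "c = (\<Prod>a\<in>A. of_real (X a) ^ M * Y a ^ (2 * M))"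
    have "T (hat ?y) j = c * expt u j" for j
    proof -
      have "P a (hat ?y) ^ nat (int M + k j a) * (of_real (w a) * Q a (hat ?y)) ^ nat (int M - k j a)
          = (of_real (X a) ^ M * Y a ^ (2 * M)) * of_real (X a) powi k j a" if a: "a \<in> A" for a
      proof -
        have X: "complex_of_real (X a) \<noteq> 0" by (simp add: X_def)
        have "of_real (X a) ^ nat (int M + k j a) = of_real (X a) powi (int M + k j a)"
          using M(1)[OF a, of j] by (simp add: power_int_def)
        also have "\<dots> = of_real (X a) ^ M * complex_of_real (X a) powi k j a"
          using X by (simp add: power_int_add)
        finally have "of_real (X a) ^ nat (int M + k j a) = of_real (X a) ^ M * complex_of_real (X a) powi k j a" .
        moreover have "Y a ^ nat (int M + k j a) * Y a ^ nat (int M - k j a) = Y a ^ (2 * M)"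
        proof -
          have "nat (int M + k j a) + nat (int M - k j a) = 2 * M" using M[OF a, of j] by linarith
          then show ?thesis by (simp flip: power_add)
        qed
        ultimately show ?thesis
          by (simp add: PX[OF a] Y_def[symmetric] power_mult_distrib mult_ac)
      qed
      then have "T (hat ?y) j = c * (\<Prod>a\<in>A. of_real (X a) powi k j a)"
        unfolding T_def c_def by (simp add: prod.distrib)
      also have "(\<Prod>a\<in>A. complex_of_real (X a) powi k j a) = expt u j"
      proof (cases j)
        case (Some i)
        have "X a powi l i a = exp (of_int (l i a) * (real_vec a \<bullet> u - ln (partition_fun u)))" for a
          by (simp add: X_def exp_power_int mult.commute)
        then have "(\<Prod>a\<in>A. X a powi l i a)
            = exp (\<Sum>a\<in>A. of_int (l i a) * (real_vec a \<bullet> u - ln (partition_fun u)))"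
          using finite_A by (simp add: exp_sum)
        also have "\<dots> = exp (u $ i)" using unit_combination_inner[OF l] by simp
        finally show ?thesis
          by (simp add: Some k_def flip: of_real_power_int of_real_prod)
      qed (simp add: k_def)
      finally show ?thesis .
    qed
    moreover have "c \<noteq> 0"
      unfolding c_def using Y finite_A by (simp add: X_def)
    ultimately show ?thesis by blast
  qed
  obtain y1 where y1: "y1 \<in> interior (Delta A)" "r (hat y1) \<noteq> 0"
    using r_nonzero homogeneous_zero_hat[OF r] by blast
  obtain u1 where u1: "barycenter (gibbs u1) = y1" using gibbs_surj_interior[OF y1(1)] .
  define \<gamma> where "\<gamma> = induced_map {z. r z \<noteq> 0} T"
  have r_DF: "r (DF (expt u)) \<noteq> 0 \<longleftrightarrow> r (hat (barycenter (gibbs u))) \<noteq> 0" for u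
  proof -
    obtain c where "c \<noteq> 0" "DF (expt u) = (\<lambda>j. c * hat (barycenter (gibbs u)) j)" by (rule DF_expt)
    then show ?thesis by (simp add: homogeneous_polyD(2)[OF r])
  qed
  have T_DF: "\<exists>c. T (DF (expt u)) = (\<lambda>j. c * expt u j)" if "r (DF (expt u)) \<noteq> 0" for u
  proof -
    obtain c where c: "DF (expt u) = (\<lambda>j. c * hat (barycenter (gibbs u)) j)" by (rule DF_expt)
    obtain c' where c': "T (hat (barycenter (gibbs u))) = (\<lambda>j. c' * expt u j)"
      using T_hat r_DF \<open>r (DF (expt u)) \<noteq> 0\<close> by blast
    have "T (DF (expt u)) j = (c ^ e * c') * expt u j" for j
      unfolding c homogeneous_polyD(2)[OF T] c' by simp
    then show ?thesis by blast
  qed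
  have DF_T: "\<exists>c. c \<noteq> 0 \<and> DF (T (hat (barycenter (gibbs u)))) = (\<lambda>j. c * hat (barycenter (gibbs u)) j)"
    if nz: "r (hat (barycenter (gibbs u))) \<noteq> 0" for u
  proof -
    obtain c where c: "c \<noteq> 0" "DF (expt u) = (\<lambda>j. c * hat (barycenter (gibbs u)) j)" by (rule DF_expt)
    obtain c' where c': "c' \<noteq> 0" "T (hat (barycenter (gibbs u))) = (\<lambda>j. c' * expt u j)"
      using T_hat[OF nz] by blast
    have "DF (T (hat (barycenter (gibbs u)))) j = (c' ^ shifted_deg * c) * hat (barycenter (gibbs u)) j" for j
      unfolding c' homogeneous_polyD(2)[OF homogeneous_DF] c by simp
    then show ?thesis using c(1) c'(1) by (intro exI[of _ "c' ^ shifted_deg * c"]) auto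
  qed
  have inverse_left: "T (DF x) i * x j = T (DF x) j * x i" if "r (DF x) \<noteq> 0" for x i j
  proof -
    \<comment> \<open>The factor \<open>r (DF x)\<close> makes the expression vanish also where the
      inverse formula fails, so it is zero at every \<open>expt u\<close> and hence
      identically.\<close>
    let ?g = "\<lambda>x. r (DF x) * (T (DF x) i * x j - T (DF x) j * x i)"
    have "homogeneous_poly (shifted_deg * n + (shifted_deg * e + 1)) ?g"
      by (intro homogeneous_poly_mult homogeneous_poly_diff homogeneous_poly_coord
          homogeneous_poly_compose[OF r] homogeneous_poly_compose[OF T] homogeneous_DF)
    then have "?g x = 0"
    proof (rule homogeneous_zero_expt)
      fix u show "?g (expt u) = 0"
        using T_DF[of u] by (cases "r (DF (expt u)) = 0") auto
    qed
    then show ?thesis using that by simp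
  qed
  have inverse_right: "DF (T z) i * z j = DF (T z) j * z i" if "r z \<noteq> 0" for z i j
  proof -
    let ?g = "\<lambda>z. r z * (DF (T z) i * z j - DF (T z) j * z i)"
    have "homogeneous_poly (n + (e * shifted_deg + 1)) ?g"
      by (intro homogeneous_poly_mult homogeneous_poly_diff homogeneous_poly_coord r
          homogeneous_poly_compose[OF homogeneous_DF] T)
    then have "?g z = 0"
    proof (rule homogeneous_zero_hat)
      fix y assume "y \<in> interior (Delta A)"
      then obtain u where "barycenter (gibbs u) = y" by (rule gibbs_surj_interior)
      then show "?g (hat y) = 0"
        using DF_T[of u] by (cases "r (hat y) = 0") auto
    qed
    then show ?thesis using that by simp
  qed
  have expt_nz: "expt u1 \<noteq> (\<lambda>_. 0)" by (auto simp: fun_eq_iff)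
  have T_nz: "T z \<noteq> (\<lambda>_. 0)" if "r z \<noteq> 0" for z
    using T_nonzero[OF that] by (auto simp: fun_eq_iff)
  have DF_nz: "DF (expt u1) \<noteq> (\<lambda>_. 0)"
  proof -
    obtain c where "c \<noteq> 0" "DF (expt u1) = (\<lambda>j. c * hat (barycenter (gibbs u1)) j)" by (rule DF_expt)
    then show ?thesis using hat_nonzero[of "barycenter (gibbs u1)"] by (auto simp: fun_eq_iff)
  qed
  have DFT_nz: "DF (T (hat y1)) \<noteq> (\<lambda>_. 0)"
    using DF_T[of u1] y1(2) hat_nonzero[of y1] unfolding u1 by (auto simp: fun_eq_iff)
  have r1: "r (DF (expt u1)) \<noteq> 0" using r_DF u1 y1(2) by simp
  note comp_left = induced_map_comp_Some_iff[OF homogeneous_torus homogeneous_DF r T]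
  note comp_right = induced_map_comp_Some_iff[OF r T homogeneous_torus homogeneous_DF]
  have "\<gamma> (proj_pt (hat y1)) = Some (proj_pt (T (hat y1)))"
    unfolding \<gamma>_def induced_map_Some_iff[OF r T] using hat_nonzero y1(2) T_nz by blast
  then have "rational_map \<gamma>"
    unfolding rational_map_def using r T by (auto simp: \<gamma>_def)
  moreover have "(\<gamma> \<circ>\<^sub>m D_torus (F_hom A w)) (proj_pt (expt u1)) = Some (proj_pt (T (DF (expt u1))))"
    unfolding \<gamma>_def D_torus_eq comp_left
    using expt_nz DF_nz r1 T_nz[OF r1] by (intro exI[of _ "expt u1"]) auto
  then have "dom (\<gamma> \<circ>\<^sub>m D_torus (F_hom A w)) \<noteq> {}" by auto
  moreover have "(D_torus (F_hom A w) \<circ>\<^sub>m \<gamma>) (proj_pt (hat y1)) = Some (proj_pt (DF (T (hat y1))))"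
    unfolding \<gamma>_def D_torus_eq comp_right
    using hat_nonzero y1(2) T_nz[OF y1(2)] T_nonzero[OF y1(2)] DFT_nz
    by (intro exI[of _ "hat y1"]) auto
  then have "dom (D_torus (F_hom A w) \<circ>\<^sub>m \<gamma>) \<noteq> {}" by auto
  moreover have left: "s = p" if comp: "(\<gamma> \<circ>\<^sub>m D_torus (F_hom A w)) p = Some s" for p s
  proof -
    obtain x where x: "x \<noteq> (\<lambda>_. 0)" "r (DF x) \<noteq> 0" "T (DF x) \<noteq> (\<lambda>_. 0)" "p = proj_pt x" "s = proj_pt (T (DF x))"
      using comp unfolding \<gamma>_def D_torus_eq comp_left by blast
    then show ?thesis using proj_pt_eqI[OF x(3,1) inverse_left[OF x(2)]] by simp
  qed
  moreover have right: "s = p" if comp: "(D_torus (F_hom A w) \<circ>\<^sub>m \<gamma>) p = Some s" for p s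
  proof -
    obtain z where z: "z \<noteq> (\<lambda>_. 0)" "r z \<noteq> 0" "DF (T z) \<noteq> (\<lambda>_. 0)" "p = proj_pt z" "s = proj_pt (DF (T z))"
      using comp unfolding \<gamma>_def D_torus_eq comp_right by blast
    then show ?thesis using proj_pt_eqI[OF z(3,1) inverse_right[OF z(2)]] by simp
  qed
  moreover have "\<forall>p\<in>dom (\<gamma> \<circ>\<^sub>m D_torus (F_hom A w)). (\<gamma> \<circ>\<^sub>m D_torus (F_hom A w)) p = Some p"
    using left by (metis domD)
  moreover have "\<forall>p\<in>dom (D_torus (F_hom A w) \<circ>\<^sub>m \<gamma>). (D_torus (F_hom A w) \<circ>\<^sub>m \<gamma>) p = Some p"
    using right by (metis domD)
  ultimately show ?thesis
    unfolding birational_isomorphism_def using rational_map_D_torus by blast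
qed

section \<open>From an inverse of the toric derivative to rational blending functions\<close>

lemma real_polynomial_Re_Im:
  assumes "complex_poly_fun g"
  shows "real_polynomial_function (\<lambda>y. Re (g (hat y))) \<and> real_polynomial_function (\<lambda>y. Im (g (hat y)))"
  using assms
proof (induction rule: complex_poly_fun.induct)
  case (coord j)
  have nth: "real_polynomial_function (\<lambda>y::real^'d. y $ i)" for i
    by (rule real_polynomial_function.intros(1)) (rule bounded_linear_vec_nth)
  show ?case
    by (cases j) (auto intro!: real_polynomial_function_diff real_polynomial_function_sum nth
        real_polynomial_function.intros(2))
qed (auto intro!: real_polynomial_function.intros(2-4) real_polynomial_function_diff)

text \<open>An inverse recovers the torus point, up to scale, as \<open>P (hat y)\<close>. Inserting
  it into the Gibbs formula gives a quotient of polynomials in \<open>y\<close>, since the scale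
  cancels between equal degrees.\<close>

lemma rational_if_birational:
  assumes bir: "birational_isomorphism (D_torus (F_hom A w))" and a: "a \<in> A"
  shows "rational_on (Delta A) (\<lambda>y. precise y a)"
proof -
  obtain \<gamma> where \<gamma>: "rational_map \<gamma>" "dom (\<gamma> \<circ>\<^sub>m D_torus (F_hom A w)) \<noteq> {}"
    "\<And>p. p \<in> dom (\<gamma> \<circ>\<^sub>m D_torus (F_hom A w)) \<Longrightarrow> (\<gamma> \<circ>\<^sub>m D_torus (F_hom A w)) p = Some p"
    using bir unfolding birational_isomorphism_def by blast
  obtain q P k m where q: "homogeneous_poly k q" and P: "\<And>j. homogeneous_poly m (\<lambda>x. P x j)"
    and \<gamma>_eq: "\<gamma> = induced_map {x. q x \<noteq> 0} P"
    using \<gamma>(1) unfolding rational_map_def by blast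
  note comp = induced_map_comp_Some_iff[OF homogeneous_torus homogeneous_DF q P]
  have inverse: "\<exists>c. c \<noteq> 0 \<and> P (DF x) = (\<lambda>j. c * x j)"
    if x: "x \<noteq> (\<lambda>_. 0)" "\<And>k. x k \<noteq> 0" "DF x \<noteq> (\<lambda>_. 0)" "q (DF x) \<noteq> 0" "P (DF x) \<noteq> (\<lambda>_. 0)" for x
  proof -
    have eq: "(\<gamma> \<circ>\<^sub>m D_torus (F_hom A w)) (proj_pt x) = Some (proj_pt (P (DF x)))"
      unfolding \<gamma>_eq D_torus_eq comp using x by (intro exI[of _ x]) auto
    then have "proj_pt x \<in> dom (\<gamma> \<circ>\<^sub>m D_torus (F_hom A w))" by (rule domI)
    then have "proj_pt (P (DF x)) = proj_pt x"
      using eq \<gamma>(3) by (metis option.inject)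
    then show ?thesis by (metis proj_pt_eqD)
  qed
  \<comment> \<open>Nonzero exactly where \<open>q\<close> is and \<open>P\<close> lands in the
    torus.\<close>
  define R where "R z = q z * (\<Prod>j\<in>UNIV. P z j)" for z
  have R: "homogeneous_poly (k + (\<Sum>j\<in>(UNIV::'d option set). m)) R"
    unfolding R_def[abs_def] by (intro homogeneous_poly_mult homogeneous_poly_prod q P)
  have P_hat: "\<exists>c. c \<noteq> 0 \<and> P (hat (barycenter (gibbs u))) = (\<lambda>j. c * expt u j)"
    if nz: "R (hat (barycenter (gibbs u))) \<noteq> 0" for u
  proof -
    let ?z = "hat (barycenter (gibbs u))"
    obtain c where c: "c \<noteq> 0" "DF (expt u) = (\<lambda>j. c * ?z j)" by (rule DF_expt)
    have z: "q ?z \<noteq> 0" "\<And>j. P ?z j \<noteq> 0" using nz by (auto simp: R_def)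
    have PDF: "P (DF (expt u)) = (\<lambda>j. c ^ m * P ?z j)"
      unfolding c(2) by (rule ext) (rule homogeneous_polyD(2)[OF P])
    have "\<exists>c'. c' \<noteq> 0 \<and> P (DF (expt u)) = (\<lambda>j. c' * expt u j)"
    proof (rule inverse)
      show "expt u \<noteq> (\<lambda>_. 0)" by (auto simp: fun_eq_iff)
      show "DF (expt u) \<noteq> (\<lambda>_. 0)"
        using c(1) hat_nonzero[of "barycenter (gibbs u)"] unfolding c(2) by (auto simp: fun_eq_iff)
      show "q (DF (expt u)) \<noteq> 0"
        using c(1) z(1) unfolding c(2) homogeneous_polyD(2)[OF q] by simp
      show "P (DF (expt u)) \<noteq> (\<lambda>_. 0)"
        using c(1) z(2) unfolding PDF by (auto simp: fun_eq_iff)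
    qed simp
    then obtain c' where c': "c' \<noteq> 0" "P (DF (expt u)) = (\<lambda>j. c' * expt u j)" by blast
    have "P ?z j = (c' / c ^ m) * expt u j" for j
      using fun_cong[OF c'(2), of j] c(1) unfolding PDF by (simp add: field_simps)
    then show ?thesis using c(1) c'(1) by (intro exI[of _ "c' / c ^ m"]) auto
  qed
  define E where "E b z = shifted_monom b (P z)" for b z
  define S where "S z = (\<Sum>b\<in>A. of_real (w b) * E b z)" for z
  have E: "complex_poly_fun (E b)" if "b \<in> A" for b
    unfolding E_def[abs_def]
    using homogeneous_poly_compose[OF homogeneous_shifted_monom[OF that] P] by (rule homogeneous_polyD(1))
  have S: "complex_poly_fun S"
    unfolding S_def[abs_def] by (intro complex_poly_fun_sum complex_poly_fun.mult complex_poly_fun.const E)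
  have SE: "S (hat (barycenter (gibbs u))) \<noteq> 0"
    "of_real (w a) * E a (hat (barycenter (gibbs u))) = of_real (gibbs u a) * S (hat (barycenter (gibbs u)))"
    if nz: "R (hat (barycenter (gibbs u))) \<noteq> 0" for u
  proof -
    let ?z = "hat (barycenter (gibbs u))"
    obtain c where c: "c \<noteq> 0" "P ?z = (\<lambda>j. c * expt u j)" using P_hat[OF nz] by blast
    define C where "C = c ^ shifted_deg * (\<Prod>k\<in>UNIV. expt u k) ^ shift"
    have C: "C \<noteq> 0" using c(1) by (simp add: C_def)
    have Eb: "E b ?z = C * of_real (exp (real_vec b \<bullet> u))" if "b \<in> A" for b
      unfolding E_def c(2) homogeneous_polyD(2)[OF homogeneous_shifted_monom[OF that]]
      by (simp add: shifted_monom_torus that expt_powi C_def)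
    then have Sz: "S ?z = C * of_real (partition_fun u)"
      by (simp add: S_def partition_fun_def sum_distrib_left mult_ac cong: sum.cong)
    show "S ?z \<noteq> 0" using C partition_fun_pos[of u] by (simp add: Sz)
    show "of_real (w a) * E a ?z = of_real (gibbs u a) * S ?z"
      using a partition_fun_pos[of u] by (simp add: Eb Sz gibbs_in)
  qed
  text \<open>Multiplying numerator and denominator by the conjugate of \<open>S\<close> makes the fraction real; the
    factor from \<open>R\<close> makes the identity hold where the inverse is undefined, too.\<close>
  define \<rho> where "\<rho> y = (Re (R (hat y)))\<^sup>2 + (Im (R (hat y)))\<^sup>2" for y
  define den where "den y = ((Re (S (hat y)))\<^sup>2 + (Im (S (hat y)))\<^sup>2) * \<rho> y" for y
  define num where "num y = w a * (Re (E a (hat y)) * Re (S (hat y)) + Im (E a (hat y)) * Im (S (hat y))) * \<rho> y" for y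
  note polys = real_polynomial_Re_Im[OF S] real_polynomial_Re_Im[OF E[OF a]]
    real_polynomial_Re_Im[OF homogeneous_polyD(1)[OF R]]
  have rp_\<rho>: "real_polynomial_function \<rho>"
    unfolding \<rho>_def[abs_def] using polys
    by (intro real_polynomial_function.intros(3) real_polynomial_function_power) auto
  have rp: "real_polynomial_function den" "real_polynomial_function num"
    unfolding den_def[abs_def] num_def[abs_def] using polys rp_\<rho>
    by (intro real_polynomial_function.intros(2-4) real_polynomial_function_power; blast)+
  have den_nonzero: "den y \<noteq> 0 \<longleftrightarrow> S (hat y) \<noteq> 0 \<and> R (hat y) \<noteq> 0" for y
    unfolding den_def \<rho>_def by (simp add: complex_eq_iff sum_power2_eq_zero_iff)
  have interior_eq: "precise y a * den y - num y = 0" if y: "y \<in> interior (Delta A)" for y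
  proof (cases "R (hat y) = 0")
    case False
    obtain u where u: "precise y = gibbs u" "barycenter (gibbs u) = y" using precise_interior[OF y] .
    have eq: "of_real (w a) * E a (hat y) = of_real (precise y a) * S (hat y)"
      using SE(2)[of u] False unfolding u by blast
    have "w a * Re (E a (hat y)) = precise y a * Re (S (hat y))"
      "w a * Im (E a (hat y)) = precise y a * Im (S (hat y))"
      using arg_cong[OF eq, of Re] arg_cong[OF eq, of Im] by simp_all
    then have "w a * (Re (E a (hat y)) * Re (S (hat y)) + Im (E a (hat y)) * Im (S (hat y)))
        = precise y a * ((Re (S (hat y)))\<^sup>2 + (Im (S (hat y)))\<^sup>2)"
      by (simp add: distrib_left power2_eq_square flip: mult.assoc)
    then show ?thesis by (simp add: den_def num_def)
  qed (simp add: den_def num_def \<rho>_def)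
  \<comment> \<open>The torus formula is available only in the interior; cross-multiplied, it
    extends to the boundary by continuity.\<close>
  have "continuous_on (closure (interior (Delta A))) (\<lambda>y. precise y a * den y - num y)"
    unfolding closure_interior_Delta
    using rp by (intro continuous_intros continuous_precise_component continuous_on_polymonial_function)
      (simp_all add: real_polynomial_function_eq)
  then have "precise y a * den y - num y = 0" if "y \<in> Delta A" for y
    using continuous_constant_on_closure[of "interior (Delta A)" "\<lambda>y. precise y a * den y - num y" 0 y]
      interior_eq that unfolding closure_interior_Delta by blast
  then have "precise y a = num y / den y" if "y \<in> Delta A" "den y \<noteq> 0" for y
    using that by (simp add: eq_divide_eq)
  \<comment> \<open>At a point where the composite is defined, \<open>P (DF x)\<close> is a multiple
    of \<open>x\<close> and so has no zero coordinate; hence \<open>R\<close> composed with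
    \<open>DF\<close> is not identically zero, and by density it is nonzero at some
    \<open>expt u\<close>.\<close>
  moreover have "\<exists>y\<in>Delta A. den y \<noteq> 0"
  proof -
    obtain p s where "(\<gamma> \<circ>\<^sub>m D_torus (F_hom A w)) p = Some s"
      using \<gamma>(2) by blast
    then obtain x where x: "x \<noteq> (\<lambda>_. 0)" "(\<Prod>k\<in>UNIV. x k) \<noteq> 0" "DF x \<noteq> (\<lambda>_. 0)"
      "q (DF x) \<noteq> 0" "P (DF x) \<noteq> (\<lambda>_. 0)"
      unfolding \<gamma>_eq D_torus_eq comp by blast
    then have xk: "x k \<noteq> 0" for k by simp
    obtain c where "c \<noteq> 0" "P (DF x) = (\<lambda>j. c * x j)" using inverse[OF x(1) xk x(3-5)] by blast
    then have "R (DF x) \<noteq> 0" using x(4) xk by (simp add: R_def)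
    then obtain u where u: "R (DF (expt u)) \<noteq> 0"
      using homogeneous_zero_expt[OF homogeneous_poly_compose[OF R, of shifted_deg DF, OF homogeneous_DF]]
      by blast
    obtain c where "DF (expt u) = (\<lambda>j. c * hat (barycenter (gibbs u)) j)" by (rule DF_expt)
    then have "R (hat (barycenter (gibbs u))) \<noteq> 0"
      using u by (auto simp: homogeneous_polyD(2)[OF R])
    then have "den (barycenter (gibbs u)) \<noteq> 0" using SE(1) den_nonzero by blast
    then show ?thesis using gibbs_closure_barycenter[OF gibbs_in_closure] by blast
  qed
  ultimately show ?thesis
    unfolding rational_on_def using rp by blast
qed

lemma rational_linear_precision_iff_birational:
  assumes "toric_patch A w \<beta>" "proper_patch A \<beta>"
  shows "rational_linear_precision A \<beta> \<longleftrightarrow> birational_isomorphism (D_torus (F_hom A w))"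
  using rational_linear_precision_iff[OF assms] birational_if_rational rational_if_birational by blast

end

theorem corollary3p13:
  fixes A :: "(int^'d) set" and w :: "int^'d \<Rightarrow> real"
  assumes "finite A"
    and "primitive A"
    and "\<forall>a\<in>A. 0 < w a"
    and "max_deg A \<noteq> 0"
  shows "((\<exists>\<beta>. toric_patch A w \<beta> \<and> rational_linear_precision A \<beta>)
            \<longleftrightarrow> birational_isomorphism (D_torus (F_hom A w))) \<and>
         (\<forall>\<beta>. toric_patch A w \<beta> \<and> proper_patch A \<beta> \<longrightarrow>
            (rational_linear_precision A \<beta>
              \<longleftrightarrow> birational_isomorphism (D_torus (F_hom A w))))"
proof -
  interpret weighted_exponents_deg A w
    using assms by unfold_locales auto
  \<comment> \<open>This reduces the existential half to the universal one; conversely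
    \<open>precise\<close> supplies the patch.\<close>
  have "proper_patch A \<beta>" if "rational_linear_precision A \<beta>" for \<beta>
    using that unfolding rational_linear_precision_def by blast
  then show ?thesis
    using rational_linear_precision_iff_birational precise_toric precise_proper by blast
qed



end
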